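(* Suppose $\varphi\in\mathrm{Der}(\mathcal{H},\mathcal{W})$ and $\varphi(\mathfrak{N})=0$. Then the following hold. (i) If $|\omega|=n$ is odd then $\varphi=0$. (ii) If $|\omega|=n$ is even then $\varphi(\mathrm{D_H}(x^{(\pi)}))=\lambda\,\mathrm{D_H}(x^{\omega})$ for some $\lambda\in\mathbb{F}$. Conversely (for $n$ even), any linear mapping $\varphi:\mathcal{H}\to\mathcal{W}$ vanishing on $\mathfrak{N}$ and satisfying $\varphi(\mathrm{D_H}(x^{(\pi)}))=\lambda\,\mathrm{D_H}(x^{\omega})$ for any fixed $\lambda\in\mathbb{F}$ is necessarily a derivation from $\mathcal{H}$ into $\mathcal{W}$.
   Context: Let $\mathbb{F}$ be a field of characteristic $p>3$, and let $m>1$, $n>3$ be integers. Put $Y_0=\{1,\dots,2m\}$, $Y_1=\{2m+1,\dots,2m+n\}$, $Y=Y_0\cup Y_1$. Fix $\underline t=(t_1,\dots,t_{2m})$ with positive integer entries, $\pi_i=p^{t_i}-1$, $\pi=(\pi_1,\dots,\pi_{2m})$, $\mathbb{A}=\{\alpha\in\mathbb{N}_0^{2m}:\alpha_i\le\pi_i\}$, $|\alpha|=\sum\alpha_i$; $\varepsilon_i$ is the $i$-th unit vector. $\mathbb{B}_k$ is the set of strictly increasing $k$-tuples $u=\langle i_1,\dots,i_k\rangle$ in $Y_1$ (also viewed as subsets), $|u|=k$, $\mathbb{B}=\bigcup_{k=0}^n\mathbb{B}_k$, $\mathbb{B}^0=\{u\in\mathbb{B}: |u|\text{ even}\}$, $x^u=x_{i_1}\cdots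 x_{i_k}$, $x^{\emptyset}=1$, $\omega=\langle 2m+1,\dots,2m+n\rangle$ (so $|\omega|=n$). $\mathcal{O}=\mathcal{O}(2m,n;\underline t)$ is the associative superalgebra with basis $\{x^{(\alpha)}x^u:\alpha\in\mathbb{A},u\in\mathbb{B}\}$ and products $x^{(\alpha)}x^{(\beta)}=\prod_i\binom{\alpha_i+\beta_i}{\alpha_i}x^{(\alpha+\beta)}$ (zero if $\alpha+\beta\notin\mathbb{A}$), $x_kx_l=-x_lx_k$, $x_k^2=0$ for $k,l\in Y_1$, $x^{(\alpha)}x_k=x_kx^{(\alpha)}$; write $x_i=x^{(\varepsilon_i)}$ for $i\in Y_0$. The parity of $x^{(\alpha)}x^u$ is $|u|$ mod 2 and its $\mathbb{Z}$-degree is $|\alpha|+|u|$. The superderivations $\partial_i$ ($i\in Y$) are $\partial_i(x^{(\alpha)}x^u)=x^{(\alpha-\varepsilon_i)}x^u$ for $i\in Y_0$ (zero if $\alpha_i=0$), and $\partial_i(x^{(\alpha)}x^u)=x^{(\alpha)}\,\partial x^u/\partial x_i$ (left derivative) for $i\in Y_1$; $\mu(i)=\overline 0$ for $i\in Y_0$, $\mu(i)=\overline 1$ for $i\in Y_1$ is the parity of $\partial_i$. $W=\{\sum_{i\in Y}a_i\partial_i: a_i\in\mathcal{O}\}$ is the generalized Witt Lie superalgebra, with bracket $[a\partial_i,b\partial_j]=a\partial_i(b)\partial_j-(-1)^{\mathrm p(a\partial_i)\mathrm p(b\partial_j)}b\partial_j(a)\partial_i$, where $\mathrm p(a\partial_i)=\mathrm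 p(a)+\mu(i)$. $\mathcal{W}$ is the even part of $W$. For $i\in Y_0$: $i'=i+m$, $\tau(i)=1$ if $i\le m$; $i'=i-m$, $\tau(i)=-1$ if $m<i\le 2m$; for $i\in Y_1$: $i'=i$, $\tau(i)=1$. Define the linear map $\mathrm{D_H}:\mathcal{O}\to W$ by $\mathrm{D_H}(a)=\sum_{i\in Y}\tau(i)(-1)^{\mu(i)\mathrm p(a)}\partial_i(a)\partial_{i'}$ for homogeneous $a$. The even part of the Hamiltonian superalgebra is $$\mathcal{H}=\mathrm{span}_{\mathbb{F}}\{\mathrm{D_H}(x^{(\alpha)}x^u):\alpha\in\mathbb{A},u\in\mathbb{B}^0,(\alpha,u)\ne(\pi,\omega)\}\subset\mathcal{W},$$ and $$\mathfrak{N}=\mathrm{span}_{\mathbb{F}}\{\mathrm{D_H}(x^{(\alpha)}x^u):\alpha\in\mathbb{A},u\in\mathbb{B}^0,(\alpha,u)\ne(\pi,\omega),(\alpha,u)\ne(\pi,\emptyset)\},$$ so that $\mathcal{H}=\mathfrak{N}\oplus\mathbb{F}\,\mathrm{D_H}(x^{(\pi)})$. A derivation from $\mathcal{H}$ into $\mathcal{W}$ is a linear map $D:\mathcal{H}\to\mathcal{W}$ with $D([x,y])=[x,D(y)]-[y,D(x)]$ for all $x,y\in\mathcal{H}$; the space of these is $\mathrm{Der}(\mathcal{H},\mathcal{W})$. *)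

theory Defs
  imports Complex_Main "HOL-Library.Function_Algebras"
begin

(* An element of O is given by its coordinates: a \<alpha> u is the coefficient of
   x^(\<alpha>) x^u.  An element of W is given by its O-coordinates: X i is the coefficient
   of \<partial>_i (W is free over O on the \<partial>_i).  Addition and subtraction are the pointwise
   ones of Function_Algebras; the pointwise product of that theory is not used. *)
type_synonym 'f superpoly = "(nat \<Rightarrow> nat) \<Rightarrow> nat set \<Rightarrow> 'f"
type_synonym 'f vfield = "nat \<Rightarrow> 'f superpoly"

definition pscale :: "'f::field \<Rightarrow> 'f superpoly \<Rightarrow> 'f superpoly" where
  "pscale c a = (\<lambda>\<alpha> u. c * a \<alpha> u)"

definition vscale :: "'f::field \<Rightarrow> 'f vfield \<Rightarrow> 'f vfield" where
  "vscale c X = (\<lambda>i. pscale c (X i))"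

global_interpretation superpoly: vector_space "pscale :: 'f::field \<Rightarrow> 'f superpoly \<Rightarrow> 'f superpoly"
  by standard (auto simp: pscale_def fun_eq_iff algebra_simps)

global_interpretation vfield: vector_space "vscale :: 'f::field \<Rightarrow> 'f vfield \<Rightarrow> 'f vfield"
  by standard (auto simp: vscale_def pscale_def fun_eq_iff algebra_simps)

definition linear_map_on :: "'f::field vfield set \<Rightarrow> ('f vfield \<Rightarrow> 'f vfield) \<Rightarrow> bool" where
  "linear_map_on V D \<longleftrightarrow>
     (\<forall>x\<in>V. \<forall>y\<in>V. D (x + y) = D x + D y) \<and> (\<forall>c. \<forall>x\<in>V. D (vscale c x) = vscale c (D x))"

definition xmono :: "(nat \<Rightarrow> nat) \<Rightarrow> nat set \<Rightarrow> 'f::field superpoly" where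
  "xmono \<alpha> u = (\<lambda>\<beta> v. if \<beta> = \<alpha> \<and> v = u then 1 else 0)"

definition unit_index :: "nat \<Rightarrow> nat \<Rightarrow> nat" where
  "unit_index i = (\<lambda>j. if j = i then 1 else 0)"

definition parity_part :: "nat \<Rightarrow> 'f::field superpoly \<Rightarrow> 'f superpoly" where
  "parity_part s a = (\<lambda>\<alpha> u. if card u mod 2 = s then a \<alpha> u else 0)"

(* The element a \<partial>_i of W. *)
definition vmono :: "'f::field superpoly \<Rightarrow> nat \<Rightarrow> 'f vfield" where
  "vmono a i = (\<lambda>j. if j = i then a else 0)"

locale hamiltonian =
  fixes m n p :: nat and t :: "nat \<Rightarrow> nat"
begin

definition "Y0 = {1..2 * m}"
definition "Y1 = {2 * m + 1..2 * m + n}"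
definition "Y = Y0 \<union> Y1"

definition top_index :: "nat \<Rightarrow> nat" where
  "top_index = (\<lambda>i. if i \<in> Y0 then p ^ t i - 1 else 0)"

(* Multi-indices are functions that vanish outside Y0. *)
definition multi_indices :: "(nat \<Rightarrow> nat) set" where
  "multi_indices = {\<alpha>. (\<forall>i\<in>Y0. \<alpha> i \<le> top_index i) \<and> (\<forall>i. i \<notin> Y0 \<longrightarrow> \<alpha> i = 0)}"

(* Strictly increasing tuples in Y1 are identified with subsets of Y1. *)
definition odd_indices :: "nat set set" where
  "odd_indices = Pow Y1"

definition even_odd_indices :: "nat set set" where
  "even_odd_indices = {u \<in> odd_indices. even (card u)}"

definition \<omega> :: "nat set" where
  "\<omega> = Y1"

definition carrier_O :: "'f::field superpoly set" where
  "carrier_O = {a. \<forall>\<alpha> u. \<not> (\<alpha> \<in> multi_indices \<and> u \<in> odd_indices) \<longrightarrow> a \<alpha> u = 0}"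

definition linear_ext :: "((nat \<Rightarrow> nat) \<Rightarrow> nat set \<Rightarrow> 'f::field superpoly) \<Rightarrow> 'f superpoly \<Rightarrow> 'f superpoly"
  where "linear_ext F a = (\<Sum>\<alpha>\<in>multi_indices. \<Sum>u\<in>odd_indices. pscale (a \<alpha> u) (F \<alpha> u))"

(* (x^(\<alpha>) x^u) (x^(\<beta>) x^v).  The sign counts the transpositions needed to sort the
   concatenation of the increasing sequences u and v. *)
definition mono_mult ::
  "(nat \<Rightarrow> nat) \<Rightarrow> nat set \<Rightarrow> (nat \<Rightarrow> nat) \<Rightarrow> nat set \<Rightarrow> 'f::field superpoly" where
  "mono_mult \<alpha> u \<beta> v =
     (if \<alpha> + \<beta> \<in> multi_indices \<and> u \<inter> v = {}
      then pscale (of_nat (\<Prod>i\<in>Y0. (\<alpha> i + \<beta> i) choose \<alpha> i)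
                     * (-1) ^ card {(k, l). k \<in> u \<and> l \<in> v \<and> l < k})
             (xmono (\<alpha> + \<beta>) (u \<union> v))
      else 0)"

definition pmult :: "'f::field superpoly \<Rightarrow> 'f superpoly \<Rightarrow> 'f superpoly" where
  "pmult a b = linear_ext (\<lambda>\<alpha> u. linear_ext (\<lambda>\<beta> v. mono_mult \<alpha> u \<beta> v) b) a"

definition mono_deriv :: "nat \<Rightarrow> (nat \<Rightarrow> nat) \<Rightarrow> nat set \<Rightarrow> 'f::field superpoly" where
  "mono_deriv i \<alpha> u =
     (if i \<in> Y0 then (if \<alpha> i = 0 then 0 else xmono (\<alpha> - unit_index i) u)
      else if i \<in> Y1 \<and> i \<in> u then pscale ((-1) ^ card {k \<in> u. k < i}) (xmono \<alpha> (u - {i}))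
      else 0)"

definition pd :: "nat \<Rightarrow> 'f::field superpoly \<Rightarrow> 'f superpoly" where
  "pd i = linear_ext (mono_deriv i)"

definition \<mu> :: "nat \<Rightarrow> nat" where
  "\<mu> i = (if i \<in> Y1 then 1 else 0)"

definition carrier_W :: "'f::field vfield set" where
  "carrier_W = {X. (\<forall>i\<in>Y. X i \<in> carrier_O) \<and> (\<forall>i. i \<notin> Y \<longrightarrow> X i = 0)}"

(* The bracket of a \<partial>_i and b \<partial>_j for a, b homogeneous of parity r, s. *)
definition mono_bracket ::
  "nat \<Rightarrow> 'f::field superpoly \<Rightarrow> nat \<Rightarrow> nat \<Rightarrow> 'f superpoly \<Rightarrow> nat \<Rightarrow> 'f vfield" where
  "mono_bracket r a i s b j =
     vmono (pmult a (pd i b)) j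
     - vscale ((-1) ^ ((r + \<mu> i) * (s + \<mu> j))) (vmono (pmult b (pd j a)) i)"

definition bracket :: "'f::field vfield \<Rightarrow> 'f vfield \<Rightarrow> 'f vfield" where
  "bracket X Z = (\<Sum>i\<in>Y. \<Sum>j\<in>Y. \<Sum>r\<in>{0, 1}. \<Sum>s\<in>{0, 1}.
     mono_bracket r (parity_part r (X i)) i s (parity_part s (Z j)) j)"

definition even_W :: "'f::field vfield set" where
  "even_W = {X \<in> carrier_W. \<forall>i\<in>Y. parity_part (\<mu> i) (X i) = X i}"

definition prime_index :: "nat \<Rightarrow> nat" where
  "prime_index i = (if i \<in> Y0 then (if i \<le> m then i + m else i - m) else i)"

definition \<tau> :: "nat \<Rightarrow> 'f::field" where
  "\<tau> i = (if m < i \<and> i \<le> 2 * m then -1 else 1)"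

definition DH :: "'f::field superpoly \<Rightarrow> 'f vfield" where
  "DH a = (\<Sum>s\<in>{0, 1}. \<Sum>i\<in>Y.
     vscale (\<tau> i * (-1) ^ (\<mu> i * s)) (vmono (pd i (parity_part s a)) (prime_index i)))"

definition even_H :: "'f::field vfield set" where
  "even_H = vfield.span {DH (xmono \<alpha> u) | \<alpha> u.
     \<alpha> \<in> multi_indices \<and> u \<in> even_odd_indices \<and> (\<alpha>, u) \<noteq> (top_index, \<omega>)}"

definition \<NN> :: "'f::field vfield set" where
  "\<NN> = vfield.span {DH (xmono \<alpha> u) | \<alpha> u.
     \<alpha> \<in> multi_indices \<and> u \<in> even_odd_indices \<and> (\<alpha>, u) \<noteq> (top_index, \<omega>) \<and> (\<alpha>, u) \<noteq> (top_index, {})}"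

(* Only the values on even_H matter: maps even_H \<rightarrow> even_W are total functions of the
   ambient type, constrained on even_H alone. *)
definition Der :: "('f::field vfield \<Rightarrow> 'f vfield) set" where
  "Der = {D. linear_map_on even_H D \<and> D ` even_H \<subseteq> even_W \<and>
     (\<forall>x\<in>even_H. \<forall>y\<in>even_H. D (bracket x y) = bracket x (D y) - bracket y (D x))}"

end

end

theory Submission
  imports Defs "HOL-Computational_Algebra.Primes"
begin

text \<open>Write \<open>{a, b}\<close> for the Poisson bracket of even elements, that is, for the Hamiltonian field
  \<open>DH a\<close> applied to \<open>b\<close>.  The Leibniz rule and supercommutativity give
  \<open>[DH a, DH b] = DH {a, b}\<close> (\<open>DH_bracket\<close>).

  A Poisson bracket never has a component at \<open>x\<^sup>\<pi>\<close> or at \<open>x\<^sup>\<pi> x\<^sup>\<omega>\<close> (\<open>poisson_top\<close>): in the even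
  variables it is a sum of derivatives, and a derivative in an even variable cannot reach the top
  multi-index; the terms of the odd variables miss these two components by parity.  Hence all
  brackets of elements of \<open>even_H\<close> lie in \<open>\<NN>\<close> (\<open>bracket_even_H\<close>).  If a derivation \<open>\<phi>\<close> vanishes on
  \<open>\<NN>\<close>, applying it to \<open>[x, y]\<close> with \<open>y\<close> in \<open>\<NN>\<close> shows that \<open>[y, \<phi> x] = 0\<close>.  So every value of \<open>\<phi>\<close>
  is an even vector field \<open>Z\<close> that commutes with \<open>\<NN>\<close>.

  Such a \<open>Z\<close> is found by testing it against few elements of \<open>\<NN>\<close>.  Commuting with the translations
  \<open>\<partial>\<^sub>k\<close> in the even variables, \<open>Z\<close> has coefficients in the odd variables only.  Commuting with the
  fields \<open>x\<^sub>k \<partial>\<^sub>k\<^sub>'\<close>, it has no even components.  Commuting with the rotations in the planes of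
  two odd variables \<open>x\<^sub>i\<close> and \<open>x\<^sub>l\<close>, its component \<open>Z j\<close> can only involve the monomials \<open>x\<^sub>j\<close> and
  \<open>\<partial>\<^sub>j x\<^sup>\<omega>\<close>, with coefficients that do not depend on \<open>j\<close>; thus \<open>Z\<close> is a combination of the Euler field
  of the odd variables and of \<open>DH x\<^sup>\<omega>\<close>.  Commuting with the field of a cubic \<open>x\<^sub>k x\<^sub>i x\<^sub>l\<close>, where \<open>k\<close>
  is even, excludes the Euler field.  The coefficients of \<open>DH x\<^sup>\<omega>\<close> have parity \<open>n - 1\<close> and those of
  \<open>Z\<close> are odd, so \<open>Z\<close> vanishes when \<open>n\<close> is odd (\<open>centralises_imp_multiple\<close>).

  Conversely, for even \<open>n\<close> the bracket \<open>{a, x\<^sup>\<omega>}\<close> vanishes for every even \<open>a\<close>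
  (\<open>poisson_xmono_omega\<close>), so both sides of the derivation rule are zero for the maps in question.\<close>

section \<open>Signs and binomial coefficients\<close>

lemma minus_one_power_cong: "even (a + b) \<Longrightarrow> (-1) ^ a = ((-1) ^ b :: 'a :: ring_1)"
  by (cases "even a") auto

lemma minus_one_power_opposite: "odd (a + b) \<Longrightarrow> (-1) ^ a = - ((-1) ^ b :: 'a :: ring_1)"
  by (cases "even a") auto

text \<open>The product of \<open>k\<close> and the binomial coefficient is a multiple of \<open>p ^ e\<close>.  If \<open>p\<close> did not
  divide the second factor, then \<open>p ^ e\<close> would have to divide \<open>k\<close>, which is too small.\<close>

lemma prime_dvd_choose_power:
  fixes p :: nat
  assumes "prime p" "0 < k" "k < p ^ e"
  shows "p dvd (p ^ e choose k)"
proof (rule ccontr)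
  assume "\<not> p dvd (p ^ e choose k)"
  then have "coprime (p ^ e) (p ^ e choose k)"
    using assms(1) prime_imp_coprime by (metis coprime_power_left_iff)
  moreover have "p ^ e dvd k * (p ^ e choose k)"
    using assms(2) by (simp add: times_binomial_minus1_eq)
  ultimately have "p ^ e dvd k"
    by (simp add: coprime_dvd_mult_left_iff)
  then show False
    using assms(2,3) dvd_imp_le leD by blast
qed

text \<open>The transpositions that sort the concatenation of the increasing sequences \<open>u\<close> and \<open>v\<close>; they
  give the sign of a product of two exterior monomials.\<close>

definition inversions :: "nat set \<Rightarrow> nat set \<Rightarrow> (nat \<times> nat) set" where
  "inversions u v = {(k, l). k \<in> u \<and> l \<in> v \<and> l < k}"

lemma finite_inversions: "finite u \<Longrightarrow> finite v \<Longrightarrow> finite (inversions u v)"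
  by (rule finite_subset[of _ "u \<times> v"]) (auto simp: inversions_def)

lemma card_inversions_insert_left:
  assumes "finite u" "finite v" "i \<notin> u"
  shows "card (inversions (insert i u) v) = card (inversions u v) + card {l \<in> v. l < i}"
proof -
  have "inversions (insert i u) v = inversions u v \<union> Pair i ` {l \<in> v. l < i}"
    by (auto simp: inversions_def)
  moreover have "inversions u v \<inter> Pair i ` {l \<in> v. l < i} = {}"
    using assms by (auto simp: inversions_def)
  ultimately show ?thesis
    using assms by (simp add: card_Un_disjoint finite_inversions card_image inj_on_def)
qed

lemma card_inversions_insert_right:
  assumes "finite u" "finite v" "i \<notin> v"
  shows "card (inversions u (insert i v)) = card (inversions u v) + card {k \<in> u. i < k}"
proof -
  have "inversions u (insert i v) = inversions u v \<union> (\<lambda>k. (k, i)) ` {k \<in> u. i < k}"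
    by (auto simp: inversions_def)
  moreover have "inversions u v \<inter> (\<lambda>k. (k, i)) ` {k \<in> u. i < k} = {}"
    using assms by (auto simp: inversions_def)
  ultimately show ?thesis
    using assms by (simp add: card_Un_disjoint finite_inversions card_image inj_on_def)
qed

text \<open>Every pair of distinct elements is out of order in exactly one of the two concatenations.\<close>

lemma card_inversions_swap:
  assumes "finite u" "finite v" "u \<inter> v = {}"
  shows "card (inversions u v) + card (inversions v u) = card u * card v"
proof -
  have "u \<times> v = inversions u v \<union> prod.swap ` inversions v u"
    using assms(3) by (auto simp: inversions_def image_iff not_less_iff_gr_or_eq)
  moreover have "inversions u v \<inter> prod.swap ` inversions v u = {}"
    by (auto simp: inversions_def)
  ultimately show ?thesis
    using assms by (simp add: card_Un_disjoint finite_inversions card_image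
        card_cartesian_product[symmetric] del: card_cartesian_product)
qed

lemma card_below_above:
  fixes i :: nat
  assumes "finite u" "i \<notin> u"
  shows "card {k \<in> u. k < i} + card {k \<in> u. i < k} = card u"
proof -
  have "u = {k \<in> u. k < i} \<union> {k \<in> u. i < k}"
    using assms(2) by (auto simp: not_less_iff_gr_or_eq)
  moreover have "card ({k \<in> u. k < i} \<union> {k \<in> u. i < k}) = card {k \<in> u. k < i} + card {k \<in> u. i < k}"
    using assms(1) by (intro card_Un_disjoint) auto
  ultimately show ?thesis
    by simp
qed

lemma card_below_Un:
  assumes "finite u" "finite v" "u \<inter> v = {}"
  shows "card {k \<in> u \<union> v. k < i} = card {k \<in> u. k < i} + card {k \<in> v. k < (i :: nat)}"
proof -
  have "{k \<in> u \<union> v. k < i} = {k \<in> u. k < i} \<union> {k \<in> v. k < i}"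
    by auto
  then show ?thesis
    using assms by (simp add: card_Un_disjoint disjoint_iff)
qed

section \<open>Coordinates and linearity\<close>

lemma sum_fun_apply: "(\<Sum>i\<in>A. f i) x = (\<Sum>i\<in>A. f i x)"
  by (induction A rule: infinite_finite_induct) auto

lemma sum_delta_pair:
  assumes "finite A" "finite B"
  shows "(\<Sum>x\<in>A. \<Sum>y\<in>B. if x = c \<and> y = d then f x y else 0)
    = (if c \<in> A \<and> d \<in> B then f c d else (0 :: 'a :: comm_monoid_add))"
proof -
  have "(\<Sum>y\<in>B. if x = c \<and> y = d then f x y else 0) = (if x = c then if d \<in> B then f x d else 0 else 0)" for x
    using assms by (cases "x = c") (auto simp: sum.delta)
  then show ?thesis
    using assms by (simp add: sum.delta)
qed

lemma pscale_apply [simp]: "pscale c a \<alpha> u = c * a \<alpha> u"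
  by (simp add: pscale_def)

lemma vscale_apply [simp]: "vscale c X i = pscale c (X i)"
  by (simp add: vscale_def)

lemma xmono_apply: "xmono \<alpha> u \<beta> v = (if \<beta> = \<alpha> \<and> v = u then 1 else 0)"
  by (simp add: xmono_def)

lemma pscale_simps [simp]:
  "pscale 0 a = 0" "pscale 1 a = a" "pscale c 0 = 0" "pscale c (pscale d a) = pscale (c * d) a"
  by (simp_all add: fun_eq_iff)

lemma pscale_add: "pscale c (a + b) = pscale c a + pscale c b"
  and pscale_diff: "pscale c (a - b) = pscale c a - pscale c b"
  and pscale_add_left: "pscale (c + d) a = pscale c a + pscale d a"
  by (simp_all add: fun_eq_iff algebra_simps)

lemma pscale_sum: "pscale c (\<Sum>i\<in>A. f i) = (\<Sum>i\<in>A. pscale c (f i))"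
  by (induction A rule: infinite_finite_induct)
    (simp_all only: sum.insert sum.infinite sum.empty not_False_eq_True pscale_add pscale_simps)

lemma vmono_apply: "vmono a i j = (if j = i then a else 0)"
  by (simp add: vmono_def)

text \<open>Zero has every parity, so the elements of a given parity form a subspace.\<close>

definition has_parity :: "nat \<Rightarrow> 'f::field superpoly \<Rightarrow> bool" where
  "has_parity s a \<longleftrightarrow> (\<forall>\<alpha> u. a \<alpha> u \<noteq> 0 \<longrightarrow> card u mod 2 = s)"

lemma parity_part_eq: "has_parity s a \<Longrightarrow> parity_part r a = (if r = s then a else 0)"
  unfolding has_parity_def parity_part_def by (intro ext) auto

lemma has_parity_iff: "parity_part s a = a \<longleftrightarrow> has_parity s a"
  unfolding has_parity_def parity_part_def fun_eq_iff by metis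

context hamiltonian
begin

lemma finite_Y0 [simp]: "finite Y0" and finite_Y1 [simp]: "finite Y1" and finite_Y [simp]: "finite Y"
  by (simp_all add: Y0_def Y1_def Y_def)

lemma Y0_Y1_disjoint: "Y0 \<inter> Y1 = {}"
  by (auto simp: Y0_def Y1_def)

lemma Y1_not_Y0: "i \<in> Y1 \<Longrightarrow> i \<notin> Y0"
  by (auto simp: Y0_def Y1_def)

lemma finite_odd_indices [simp]: "finite odd_indices"
  by (simp add: odd_indices_def)

lemma odd_indices_finite: "u \<in> odd_indices \<Longrightarrow> finite u"
  using finite_subset[OF _ finite_Y1] by (simp add: odd_indices_def)

lemma zero_multi: "0 \<in> multi_indices"
  by (simp add: multi_indices_def)

lemma empty_odd: "{} \<in> odd_indices"
  by (simp add: odd_indices_def)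

lemma finite_multi_indices [simp]: "finite multi_indices"
proof (rule finite_subset)
  show "multi_indices \<subseteq> {f. \<forall>i. (i \<in> Y0 \<longrightarrow> f i \<in> (\<Union>j\<in>Y0. {..top_index j})) \<and> (i \<notin> Y0 \<longrightarrow> f i = 0)}"
    by (auto simp: multi_indices_def)
  show "finite \<dots>"
    by (rule finite_set_of_finite_funs) auto
qed

lemma linear_ext_apply:
  "linear_ext F a \<gamma> w = (\<Sum>\<alpha>\<in>multi_indices. \<Sum>u\<in>odd_indices. a \<alpha> u * F \<alpha> u \<gamma> w)"
  by (simp add: linear_ext_def sum_fun_apply)

lemma linear_ext_linear:
  "linear_ext F (a + b) = linear_ext F a + linear_ext F b"
  "linear_ext F (a - b) = linear_ext F a - linear_ext F b"
  "linear_ext F (pscale c a) = pscale c (linear_ext F a)"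
  "linear_ext F 0 = 0"
  "linear_ext F (- a) = - linear_ext F a"
  by (simp_all add: fun_eq_iff linear_ext_apply algebra_simps sum.distrib sum_subtractf sum_distrib_left sum_negf)

lemma linear_ext_fun_linear:
  "linear_ext (\<lambda>\<alpha> u. F \<alpha> u + G \<alpha> u) a = linear_ext F a + linear_ext G a"
  "linear_ext (\<lambda>\<alpha> u. F \<alpha> u - G \<alpha> u) a = linear_ext F a - linear_ext G a"
  "linear_ext (\<lambda>\<alpha> u. pscale c (F \<alpha> u)) a = pscale c (linear_ext F a)"
  "linear_ext (\<lambda>\<alpha> u. 0) a = 0"
  "linear_ext (\<lambda>\<alpha> u. - F \<alpha> u) a = - linear_ext F a"
  by (simp_all add: fun_eq_iff linear_ext_apply algebra_simps sum.distrib sum_subtractf sum_distrib_left sum_negf)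

lemma linear_ext_xmono:
  "linear_ext F (xmono \<alpha> u) = (if \<alpha> \<in> multi_indices \<and> u \<in> odd_indices then F \<alpha> u else 0)"
proof (intro ext)
  fix \<gamma> w
  have "linear_ext F (xmono \<alpha> u) \<gamma> w
      = (\<Sum>\<beta>\<in>multi_indices. \<Sum>v\<in>odd_indices. if \<beta> = \<alpha> \<and> v = u then F \<beta> v \<gamma> w else 0)"
    unfolding linear_ext_apply by (intro sum.cong) (auto simp: xmono_apply)
  also have "\<dots> = (if \<alpha> \<in> multi_indices \<and> u \<in> odd_indices then F \<alpha> u else 0) \<gamma> w"
    by (simp add: sum_delta_pair)
  finally show "linear_ext F (xmono \<alpha> u) \<gamma> w = \<dots>" .
qed

lemma pmult_linear_left:
  "pmult (a + b) c = pmult a c + pmult b c"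
  "pmult (a - b) c = pmult a c - pmult b c"
  "pmult (pscale k a) c = pscale k (pmult a c)"
  "pmult 0 c = 0"
  "pmult (- a) c = - pmult a c"
  by (simp_all add: pmult_def linear_ext_linear)

lemma pmult_linear_right:
  "pmult c (a + b) = pmult c a + pmult c b"
  "pmult c (a - b) = pmult c a - pmult c b"
  "pmult c (pscale k a) = pscale k (pmult c a)"
  "pmult c 0 = 0"
  "pmult c (- a) = - pmult c a"
  by (simp_all add: pmult_def linear_ext_linear linear_ext_fun_linear)

lemma pmult_xmono:
  assumes "\<alpha> \<in> multi_indices" "u \<in> odd_indices" "\<beta> \<in> multi_indices" "v \<in> odd_indices"
  shows "pmult (xmono \<alpha> u) (xmono \<beta> v) = mono_mult \<alpha> u \<beta> v"
  using assms by (simp add: pmult_def linear_ext_xmono)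

lemma pd_linear:
  "pd i (a + b) = pd i a + pd i b"
  "pd i (a - b) = pd i a - pd i b"
  "pd i (pscale c a) = pscale c (pd i a)"
  "pd i 0 = 0"
  "pd i (- a) = - pd i a"
  by (simp_all add: pd_def linear_ext_linear)

lemma pd_sum: "pd i (\<Sum>j\<in>A. f j) = (\<Sum>j\<in>A. pd i (f j))"
  by (induction A rule: infinite_finite_induct)
    (simp_all only: sum.insert sum.infinite sum.empty not_False_eq_True pd_linear )

lemma pd_xmono: "\<alpha> \<in> multi_indices \<Longrightarrow> u \<in> odd_indices \<Longrightarrow> pd i (xmono \<alpha> u) = mono_deriv i \<alpha> u"
  by (simp add: pd_def linear_ext_xmono)

lemma carrier_OD: "a \<in> carrier_O \<Longrightarrow> a \<alpha> u \<noteq> 0 \<Longrightarrow> \<alpha> \<in> multi_indices \<and> u \<in> odd_indices"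
  by (auto simp: carrier_O_def)

lemma carrier_O_closed [intro, simp]:
  "0 \<in> carrier_O"
  "a \<in> carrier_O \<Longrightarrow> b \<in> carrier_O \<Longrightarrow> a + b \<in> carrier_O"
  "a \<in> carrier_O \<Longrightarrow> b \<in> carrier_O \<Longrightarrow> a - b \<in> carrier_O"
  "a \<in> carrier_O \<Longrightarrow> pscale c a \<in> carrier_O"
  "\<alpha> \<in> multi_indices \<Longrightarrow> u \<in> odd_indices \<Longrightarrow> xmono \<alpha> u \<in> carrier_O"
  by (auto simp: carrier_O_def xmono_apply)

lemma carrier_O_sum [intro]: "(\<And>i. i \<in> A \<Longrightarrow> f i \<in> carrier_O) \<Longrightarrow> (\<Sum>i\<in>A. f i) \<in> carrier_O"
  by (induction A rule: infinite_finite_induct) auto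

lemma carrier_O_expansion:
  assumes "a \<in> carrier_O"
  shows "a = (\<Sum>\<alpha>\<in>multi_indices. \<Sum>u\<in>odd_indices. pscale (a \<alpha> u) (xmono \<alpha> u))"
proof (intro ext)
  fix \<gamma> w
  have "(\<Sum>\<alpha>\<in>multi_indices. \<Sum>u\<in>odd_indices. pscale (a \<alpha> u) (xmono \<alpha> u)) \<gamma> w
      = (\<Sum>\<alpha>\<in>multi_indices. \<Sum>u\<in>odd_indices. if \<alpha> = \<gamma> \<and> u = w then a \<alpha> u else 0)"
    unfolding sum_fun_apply by (intro sum.cong) (auto simp: xmono_apply)
  also have "\<dots> = a \<gamma> w"
    using assms by (auto simp: sum_delta_pair carrier_O_def)
  finally show "a \<gamma> w = (\<Sum>\<alpha>\<in>multi_indices. \<Sum>u\<in>odd_indices. pscale (a \<alpha> u) (xmono \<alpha> u)) \<gamma> w" ..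
qed

text \<open>Linear statements need only be checked on the monomials that occur in the given element, so
  a parity hypothesis on that element passes to those monomials.\<close>

lemma carrier_O_induct:
  assumes "a \<in> carrier_O"
    and mono: "\<And>\<alpha> u. \<alpha> \<in> multi_indices \<Longrightarrow> u \<in> odd_indices \<Longrightarrow> a \<alpha> u \<noteq> 0 \<Longrightarrow> P (xmono \<alpha> u)"
    and zero: "P 0"
    and add: "\<And>x y. P x \<Longrightarrow> P y \<Longrightarrow> P (x + y)"
    and scale: "\<And>c x. P x \<Longrightarrow> P (pscale c x)"
  shows "P a"
proof -
  have sum: "P (\<Sum>i\<in>A. f i)" if "\<And>i. i \<in> A \<Longrightarrow> P (f i)" for A :: "'b set" and f
    using that by (induction A rule: infinite_finite_induct) (auto simp: zero add)
  have sum': "P (\<Sum>i\<in>A. f i)" if "\<And>i. i \<in> A \<Longrightarrow> P (f i)" for A :: "'c set" and f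
    using that by (induction A rule: infinite_finite_induct) (auto simp: zero add)
  have "P (pscale (a \<alpha> u) (xmono \<alpha> u))" if "\<alpha> \<in> multi_indices" "u \<in> odd_indices" for \<alpha> u
    using that mono[of \<alpha> u] by (cases "a \<alpha> u = 0") (auto simp: zero scale)
  then show ?thesis
    by (subst carrier_O_expansion[OF assms(1)]) (intro sum sum')
qed

lemma pd_even_apply:
  assumes "i \<in> Y0"
  shows "pd i a \<gamma> w = (if \<gamma> + unit_index i \<in> multi_indices \<and> w \<in> odd_indices
    then a (\<gamma> + unit_index i) w else 0)"
proof -
  have *: "\<alpha> i \<noteq> 0 \<and> \<gamma> = \<alpha> - unit_index i \<longleftrightarrow> \<alpha> = \<gamma> + unit_index i" for \<alpha> :: "nat \<Rightarrow> nat"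
    unfolding fun_eq_iff unit_index_def by (auto split: if_splits)
  have "pd i a \<gamma> w = (\<Sum>\<alpha>\<in>multi_indices. \<Sum>u\<in>odd_indices.
      if \<alpha> = \<gamma> + unit_index i \<and> u = w then a \<alpha> u else 0)"
    unfolding pd_def linear_ext_apply *[symmetric]
    using assms by (intro sum.cong) (auto simp: mono_deriv_def xmono_apply)
  then show ?thesis
    by (simp add: sum_delta_pair)
qed

lemma pd_odd_apply:
  assumes "i \<in> Y1"
  shows "pd i a \<gamma> w = (if \<gamma> \<in> multi_indices \<and> w \<in> odd_indices \<and> i \<notin> w
    then (-1) ^ card {k \<in> w. k < i} * a \<gamma> (insert i w) else 0)"
proof -
  have "pd i a \<gamma> w = (\<Sum>\<alpha>\<in>multi_indices. \<Sum>u\<in>odd_indices.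
      if \<alpha> = \<gamma> \<and> u = insert i w then if i \<notin> w then (-1) ^ card {k \<in> u. k < i} * a \<alpha> u else 0 else 0)"
    unfolding pd_def linear_ext_apply
    using assms by (intro sum.cong refl) (auto simp: mono_deriv_def xmono_apply Y1_not_Y0)
  moreover have "{k. (k = i \<or> k \<in> w) \<and> k < i} = {k \<in> w. k < i}"
    by auto
  ultimately show ?thesis
    using assms by (auto simp: sum_delta_pair odd_indices_def)
qed

lemma pd_carrier [simp, intro]: "i \<in> Y \<Longrightarrow> pd i a \<in> carrier_O"
proof -
  have "\<gamma> \<in> multi_indices" if "\<gamma> + unit_index i \<in> multi_indices" for \<gamma>
    using that by (fastforce simp: multi_indices_def unit_index_def split: if_splits)
  then show "i \<in> Y \<Longrightarrow> pd i a \<in> carrier_O"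
    by (auto simp: Y_def carrier_O_def pd_even_apply pd_odd_apply)
qed

section \<open>Products of monomials\<close>

definition multi_choose :: "(nat \<Rightarrow> nat) \<Rightarrow> (nat \<Rightarrow> nat) \<Rightarrow> nat" where
  "multi_choose \<alpha> \<beta> = (\<Prod>i\<in>Y0. (\<alpha> i + \<beta> i) choose \<alpha> i)"

lemma mono_mult_eq:
  "mono_mult \<alpha> u \<beta> v = (if \<alpha> + \<beta> \<in> multi_indices \<and> u \<inter> v = {}
    then pscale (of_nat (multi_choose \<alpha> \<beta>) * (-1) ^ card (inversions u v)) (xmono (\<alpha> + \<beta>) (u \<union> v))
    else 0)"
  by (simp add: mono_mult_def multi_choose_def inversions_def)

lemma multi_choose_commute: "multi_choose \<alpha> \<beta> = multi_choose \<beta> \<alpha>"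
  unfolding multi_choose_def
  by (intro prod.cong refl) (metis add.commute add_diff_cancel_left' binomial_symmetric le_add1)

lemma odd_indices_Un: "u \<in> odd_indices \<Longrightarrow> v \<in> odd_indices \<Longrightarrow> u \<union> v \<in> odd_indices"
  by (auto simp: odd_indices_def)

lemma odd_indices_insert [simp]: "i \<in> Y1 \<Longrightarrow> insert i u \<in> odd_indices \<longleftrightarrow> u \<in> odd_indices"
  by (auto simp: odd_indices_def)

lemma mono_mult_carrier [simp]:
  "u \<in> odd_indices \<Longrightarrow> v \<in> odd_indices \<Longrightarrow> mono_mult \<alpha> u \<beta> v \<in> carrier_O"
  by (simp add: mono_mult_eq odd_indices_Un)

lemma linear_ext_carrier:
  "(\<And>\<alpha> u. \<alpha> \<in> multi_indices \<Longrightarrow> u \<in> odd_indices \<Longrightarrow> F \<alpha> u \<in> carrier_O) \<Longrightarrow> linear_ext F a \<in> carrier_O"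
  unfolding linear_ext_def by (intro carrier_O_sum carrier_O_closed(4)) auto

lemma pmult_carrier [simp]: "pmult a b \<in> carrier_O"
  unfolding pmult_def by (intro linear_ext_carrier) simp

lemma has_parity_zero_iff: "has_parity s a \<longleftrightarrow> (\<forall>\<alpha> u. card u mod 2 \<noteq> s \<longrightarrow> a \<alpha> u = 0)"
  by (auto simp: has_parity_def)

lemma has_parity_closed:
  "has_parity s 0"
  "has_parity s a \<Longrightarrow> has_parity s b \<Longrightarrow> has_parity s (a + b)"
  "has_parity s a \<Longrightarrow> has_parity s b \<Longrightarrow> has_parity s (a - b)"
  "has_parity s a \<Longrightarrow> has_parity s (pscale c a)"
  by (simp_all add: has_parity_zero_iff)

lemma has_parity_xmono: "card u mod 2 = s \<Longrightarrow> has_parity s (xmono \<alpha> u)"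
  by (simp add: has_parity_def xmono_apply)

lemma has_parity_mono_mult:
  assumes "u \<in> odd_indices" "v \<in> odd_indices"
  shows "has_parity ((card u + card v) mod 2) (mono_mult \<alpha> u \<beta> v)"
  using assms
  by (auto simp: mono_mult_eq odd_indices_finite card_Un_disjoint
      intro!: has_parity_closed has_parity_xmono)

lemma has_parity_pmult:
  assumes "a \<in> carrier_O" "has_parity r a" "b \<in> carrier_O" "has_parity s b"
  shows "has_parity ((r + s) mod 2) (pmult a b)"
proof (rule carrier_O_induct[OF assms(1), where P = "\<lambda>x. has_parity ((r + s) mod 2) (pmult x b)"])
  fix \<alpha> u
  assume u: "\<alpha> \<in> multi_indices" "u \<in> odd_indices" "a \<alpha> u \<noteq> 0"
  show "has_parity ((r + s) mod 2) (pmult (xmono \<alpha> u) b)"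
  proof (rule carrier_O_induct[OF assms(3), where P = "\<lambda>x. has_parity ((r + s) mod 2) (pmult (xmono \<alpha> u) x)"])
    fix \<beta> v
    assume v: "\<beta> \<in> multi_indices" "v \<in> odd_indices" "b \<beta> v \<noteq> 0"
    have "card u mod 2 = r" "card v mod 2 = s"
      using u v assms by (auto simp: has_parity_def)
    then have "(card u + card v) mod 2 = (r + s) mod 2"
      by (metis mod_add_eq)
    then show "has_parity ((r + s) mod 2) (pmult (xmono \<alpha> u) (xmono \<beta> v))"
      using u v has_parity_mono_mult[of u v \<alpha> \<beta>] by (simp add: pmult_xmono)
  qed (simp_all add: pmult_linear_right has_parity_closed)
qed (simp_all add: pmult_linear_left has_parity_closed)

lemma has_parity_pd:
  assumes "has_parity s a" "i \<in> Y"
  shows "has_parity ((s + \<mu> i) mod 2) (pd i a)"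
proof (cases "i \<in> Y0")
  case True
  then have "\<mu> i = 0"
    using Y0_Y1_disjoint by (auto simp: \<mu>_def)
  with True show ?thesis
    using assms(1) by (auto simp: has_parity_zero_iff pd_even_apply) (metis mod_mod_trivial)
next
  case False
  with assms(2) have i: "i \<in> Y1" "\<mu> i = 1"
    by (auto simp: Y_def \<mu>_def)
  show ?thesis
    unfolding has_parity_def
  proof (intro allI impI)
    fix \<gamma> w
    assume "pd i a \<gamma> w \<noteq> 0"
    then have w: "w \<in> odd_indices" "i \<notin> w" and "a \<gamma> (insert i w) \<noteq> 0"
      using i by (auto simp: pd_odd_apply split: if_splits)
    then have "card (insert i w) mod 2 = s"
      using assms(1) by (auto simp: has_parity_def)
    then show "card w mod 2 = (s + \<mu> i) mod 2"
      using w i odd_indices_finite by (auto simp: mod2_eq_if split: if_splits)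
  qed
qed

lemma mono_mult_supercommute:
  assumes "u \<in> odd_indices" "v \<in> odd_indices"
  shows "mono_mult \<alpha> u \<beta> v = pscale ((-1) ^ (card u * card v)) (mono_mult \<beta> v \<alpha> u)"
proof -
  have "(-1) ^ card (inversions u v) = ((-1) ^ (card u * card v) * (-1) ^ card (inversions v u) :: 'a)"
    if "u \<inter> v = {}"
    unfolding power_add[symmetric]
    using card_inversions_swap[of u v] that assms odd_indices_finite
    by (intro minus_one_power_cong) (metis add.assoc add.commute even_add)
  then show ?thesis
    by (auto simp: mono_mult_eq multi_choose_commute[of \<alpha>] add.commute[of \<alpha>] Un_commute[of u] Int_commute[of u])
qed

lemma pmult_supercommute:
  fixes a b :: "'f::field superpoly"
  assumes "a \<in> carrier_O" "has_parity r a" "b \<in> carrier_O" "has_parity s b"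
  shows "pmult a b = pscale ((-1) ^ (r * s)) (pmult b a)"
proof (rule carrier_O_induct[OF assms(1), where P = "\<lambda>x. pmult x b = pscale ((-1) ^ (r * s)) (pmult b x)"])
  fix \<alpha> u
  assume u: "\<alpha> \<in> multi_indices" "u \<in> odd_indices" "a \<alpha> u \<noteq> 0"
  show "pmult (xmono \<alpha> u) b = pscale ((-1) ^ (r * s)) (pmult b (xmono \<alpha> u))"
  proof (rule carrier_O_induct[OF assms(3),
        where P = "\<lambda>x. pmult (xmono \<alpha> u) x = pscale ((-1) ^ (r * s)) (pmult x (xmono \<alpha> u))"])
    fix \<beta> v
    assume v: "\<beta> \<in> multi_indices" "v \<in> odd_indices" "b \<beta> v \<noteq> 0"
    have "card u mod 2 = r" "card v mod 2 = s"
      using u v assms by (auto simp: has_parity_def)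
    then have "(-1) ^ (r * s) = ((-1) ^ (card u * card v) :: 'f)"
      by (intro minus_one_power_cong) auto
    then show "pmult (xmono \<alpha> u) (xmono \<beta> v)
        = pscale ((-1) ^ (r * s)) (pmult (xmono \<beta> v) (xmono \<alpha> u) :: 'f superpoly)"
      using u v by (simp add: pmult_xmono mono_mult_supercommute[of u v \<alpha> \<beta>])
  qed (simp_all add: pmult_linear_right pmult_linear_left pscale_add mult.commute)
qed (simp_all add: pmult_linear_right pmult_linear_left pscale_add mult.commute)

lemma pmult_odd_variable_apply:
  assumes "j \<in> Y1" "g \<in> carrier_O"
  shows "pmult (xmono 0 {j}) g \<gamma> w
    = (if j \<in> w then (-1) ^ card {k \<in> w. k < j} * g \<gamma> (w - {j}) else 0)"
proof -
  have inv: "card (inversions {j} v) = card {k \<in> v. k < j}" if "v \<in> odd_indices" for v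
    using card_inversions_insert_left[of "{}" v j] odd_indices_finite[OF that]
    by (simp add: inversions_def)
  have below: "{k. (k = j \<or> k \<in> v) \<and> k < j} = {k \<in> v. k < j}" for v
    by auto
  have "pmult (xmono 0 {j}) g = linear_ext (mono_mult 0 {j}) g"
    using assms zero_multi by (simp add: pmult_def linear_ext_xmono odd_indices_def)
  then have "pmult (xmono 0 {j}) g \<gamma> w = (\<Sum>\<beta>\<in>multi_indices. \<Sum>v\<in>odd_indices.
      g \<beta> v * mono_mult 0 {j} \<beta> v \<gamma> w)"
    by (simp add: linear_ext_apply)
  also have "\<dots> = (\<Sum>\<beta>\<in>multi_indices. \<Sum>v\<in>odd_indices.
      if \<beta> = \<gamma> \<and> v = w - {j} then if j \<in> w then (-1) ^ card {k \<in> w. k < j} * g \<beta> v else 0 else 0)"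
    by (intro sum.cong refl)
      (auto simp: mono_mult_eq multi_choose_def inv xmono_apply below)
  finally show ?thesis
    using assms carrier_OD[OF assms(2), of \<gamma> "w - {j}"] by (auto simp: sum_delta_pair)
qed

lemma pmult_one_left:
  assumes "g \<in> carrier_O"
  shows "pmult (xmono 0 {}) g = g"
proof (rule carrier_O_induct[OF assms, where P = "\<lambda>x. pmult (xmono 0 {}) x = x"])
  fix \<beta> v
  assume "\<beta> \<in> multi_indices" "v \<in> odd_indices"
  then show "pmult (xmono 0 {}) (xmono \<beta> v) = xmono \<beta> v"
    by (simp add: zero_multi empty_odd pmult_xmono mono_mult_eq multi_choose_def inversions_def)
qed (simp_all add: pmult_linear_right)

section \<open>Commutation and the odd Leibniz rule\<close>

lemma pd_commute:
  assumes "i \<in> Y" "j \<in> Y"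
  shows "pd i (pd j a) = pscale ((-1) ^ (\<mu> i * \<mu> j)) (pd j (pd i a))"
proof (intro ext)
  fix \<gamma> w
  have smaller: "\<gamma> + unit_index k \<in> multi_indices" if "\<gamma> + unit_index k + unit_index l \<in> multi_indices" for k l
    using that by (fastforce simp: multi_indices_def unit_index_def split: if_splits)
  have smaller': "\<gamma> \<in> multi_indices" if "\<gamma> + unit_index l \<in> multi_indices" for l
    using that by (fastforce simp: multi_indices_def unit_index_def split: if_splits)
  consider "i \<in> Y0" "j \<in> Y0" | "i \<in> Y0" "j \<in> Y1" | "i \<in> Y1" "j \<in> Y0" | "i \<in> Y1" "j \<in> Y1"
    using assms by (auto simp: Y_def)
  then show "pd i (pd j a) \<gamma> w = pscale ((-1) ^ (\<mu> i * \<mu> j)) (pd j (pd i a)) \<gamma> w"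
  proof cases
    case 1
    then have "\<mu> i = 0"
      using Y0_Y1_disjoint by (auto simp: \<mu>_def)
    moreover have "\<gamma> + unit_index i + unit_index j = \<gamma> + unit_index j + unit_index i"
      by (simp add: ac_simps)
    ultimately show ?thesis
      using 1 smaller[of i j] smaller[of j i] by (auto simp: pd_even_apply)
  next
    case 4
    show ?thesis
    proof (cases "i = j \<or> i \<in> w \<or> j \<in> w \<or> \<gamma> \<notin> multi_indices \<or> w \<notin> odd_indices")
      case True
      with 4 show ?thesis
        by (auto simp: pd_odd_apply)
    next
      case False
      then have "insert i w \<in> odd_indices" "insert j w \<in> odd_indices" "finite w"
        using 4 by (auto simp: odd_indices_def odd_indices_finite)
      moreover have below: "card {k \<in> insert k' w. k < l} = card {k \<in> w. k < l} + (if k' < l then 1 else 0)"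
        if "k' \<notin> w" for k' l
      proof -
        have "{k \<in> insert k' w. k < l} = (if k' < l then insert k' {k \<in> w. k < l} else {k \<in> w. k < l})"
          by auto
        then show ?thesis
          using that \<open>finite w\<close> by simp
      qed
      moreover have "\<mu> i = 1" "\<mu> j = 1"
        using 4 by (auto simp: \<mu>_def)
      moreover have "i < j \<longleftrightarrow> \<not> j < i"
        using False by auto
      ultimately show ?thesis
        using 4 False below[of i j] below[of j i]
        by (auto simp: pd_odd_apply insert_commute power_add)
    qed
  qed (use Y0_Y1_disjoint smaller' in \<open>auto simp: pd_even_apply pd_odd_apply \<mu>_def\<close>)
qed

lemma minus_unit_multi: "\<alpha> \<in> multi_indices \<Longrightarrow> \<alpha> - unit_index i \<in> multi_indices"
  by (auto simp: multi_indices_def le_diff_conv trans_le_add1)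

text \<open>All signs count transpositions; what matters is how these counts change when \<open>i\<close> is removed
  from one of the two index sets.\<close>

lemma pd_mono_mult_odd:
  assumes i: "i \<in> Y1" and "u \<in> odd_indices" "v \<in> odd_indices"
  shows "pd i (mono_mult \<alpha> u \<beta> v :: 'f::field superpoly)
    = (if i \<in> u then pscale ((-1) ^ card {k \<in> u. k < i}) (mono_mult \<alpha> (u - {i}) \<beta> v) else 0)
      + pscale ((-1) ^ card u)
          (if i \<in> v then pscale ((-1) ^ card {k \<in> v. k < i}) (mono_mult \<alpha> u \<beta> (v - {i})) else 0)"
proof (cases "\<alpha> + \<beta> \<in> multi_indices")
  case False
  then show ?thesis
    by (simp add: mono_mult_eq pd_linear)
next
  case multi: True
  have fin: "finite u" "finite v"
    using assms odd_indices_finite by auto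
  have below: "{k. (k = i \<or> k \<in> w) \<and> k < i} = {k \<in> w. k < i}" for w
    by auto
  have deriv: "pd i (xmono (\<alpha> + \<beta>) w :: 'f superpoly)
      = pscale ((-1) ^ card {k \<in> w. k < i}) (xmono (\<alpha> + \<beta>) (w - {i}))"
    if "i \<in> w" "w \<in> odd_indices" for w
    using that multi i Y1_not_Y0 by (simp add: pd_xmono mono_deriv_def)
  have Un: "u \<union> v \<in> odd_indices"
    using assms by (simp add: odd_indices_Un)
  consider "i \<in> u" "i \<in> v" | "i \<in> u" "i \<notin> v" | "i \<notin> u" "i \<in> v" | "i \<notin> u" "i \<notin> v"
    by blast
  then show ?thesis
  proof cases
    (* i occurs in both factors: the product is zero, and the two terms on the right cancel *)
    case 1
    then obtain u' v' where u': "u = insert i u'" "i \<notin> u'" and v': "v = insert i v'" "i \<notin> v'"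
      by (meson mk_disjoint_insert)
    have fin': "finite u'" "finite v'"
      using fin u' v' by auto
    have total: "card {k \<in> u'. k < i} + card (inversions u' v)
          + (card u + (card {k \<in> v'. k < i} + card (inversions u v')))
        = Suc (2 * (card u' + card (inversions u' v') + card {k \<in> v'. k < i}))"
      using card_below_above[of u' i] u' v' fin'
      by (simp add: card_inversions_insert_left card_inversions_insert_right)
    have "(-1) ^ card {k \<in> u'. k < i} * (-1) ^ card (inversions u' v)
        = - ((-1) ^ card u * ((-1) ^ card {k \<in> v'. k < i} * (-1) ^ card (inversions u v')) :: 'f)"
      unfolding power_add[symmetric] by (intro minus_one_power_opposite, unfold total) simp
    then have "pscale (c * ((-1) ^ card {k \<in> u'. k < i} * (-1) ^ card (inversions u' v))) x
        + pscale (c * ((-1) ^ card u * ((-1) ^ card {k \<in> v'. k < i} * (-1) ^ card (inversions u v')))) x = 0"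
      for c :: 'f and x
      by (simp add: pscale_add_left[symmetric] del: mult_minus_right) simp
    then show ?thesis
      using u' v' multi by (auto simp: mono_mult_eq pd_linear below mult_ac)
  next
    case 2
    then obtain u' where u': "u = insert i u'" "i \<notin> u'"
      by (meson mk_disjoint_insert)
    have fin': "finite u'"
      using fin u' by auto
    show ?thesis
    proof (cases "u \<inter> v = {}")
      case True
      then have disjoint: "u' \<inter> v = {}"
        using u' by auto
      have total: "card (inversions u v) + card {k \<in> u \<union> v. k < i}
            + (card {k \<in> u'. k < i} + card (inversions u' v))
          = 2 * (card {k \<in> u'. k < i} + card {k \<in> v. k < i} + card (inversions u' v))"
        unfolding card_below_Un[OF fin True] using u' fin fin'
        by (simp add: card_inversions_insert_left below)
      have "(-1) ^ card (inversions u v) * (-1) ^ card {k \<in> u \<union> v. k < i}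
          = ((-1) ^ card {k \<in> u'. k < i} * (-1) ^ card (inversions u' v) :: 'f)"
        unfolding power_add[symmetric] by (intro minus_one_power_cong, unfold total) simp
      moreover have "u \<union> v - {i} = u' \<union> v" "u - {i} = u'" "{k \<in> u. k < i} = {k \<in> u'. k < i}"
        using u' 2 by auto
      ultimately show ?thesis
        using 2 True disjoint multi Un by (simp add: mono_mult_eq pd_linear deriv mult_ac)
    next
      case False
      then have "(u - {i}) \<inter> v \<noteq> {}"
        using 2 by auto
      with False 2 show ?thesis
        by (simp add: mono_mult_eq pd_linear)
    qed
  next
    case 3
    then obtain v' where v': "v = insert i v'" "i \<notin> v'"
      by (meson mk_disjoint_insert)
    have fin': "finite v'"
      using fin v' by auto
    show ?thesis
    proof (cases "u \<inter> v = {}")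
      case True
      then have disjoint: "u \<inter> v' = {}"
        using v' by auto
      have total: "card (inversions u v) + card {k \<in> u \<union> v. k < i}
            + (card u + (card {k \<in> v'. k < i} + card (inversions u v')))
          = 2 * (card u + card {k \<in> v'. k < i} + card (inversions u v'))"
        unfolding card_below_Un[OF fin True] using v' fin fin' 3 card_below_above[of u i]
        by (simp add: card_inversions_insert_right below)
      have "(-1) ^ card (inversions u v) * (-1) ^ card {k \<in> u \<union> v. k < i}
          = ((-1) ^ card u * ((-1) ^ card {k \<in> v'. k < i} * (-1) ^ card (inversions u v')) :: 'f)"
        unfolding power_add[symmetric] by (intro minus_one_power_cong, unfold total) simp
      moreover have "u \<union> v - {i} = u \<union> v'" "v - {i} = v'" "{k \<in> v. k < i} = {k \<in> v'. k < i}"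
        using v' 3 by auto
      ultimately show ?thesis
        using 3 True disjoint multi Un by (simp add: mono_mult_eq pd_linear deriv mult_ac)
    next
      case False
      then have "u \<inter> (v - {i}) \<noteq> {}"
        using 3 by auto
      with False 3 show ?thesis
        by (simp add: mono_mult_eq pd_linear)
    qed
  next
    case 4
    then have "pd i (xmono (\<alpha> + \<beta>) (u \<union> v) :: 'f superpoly) = 0"
      using i Y1_not_Y0 multi Un by (simp add: pd_xmono mono_deriv_def)
    with 4 show ?thesis
      by (simp add: mono_mult_eq pd_linear)
  qed
qed

lemma pmult_mono_deriv:
  assumes "\<alpha> \<in> multi_indices" "u \<in> odd_indices" "\<beta> \<in> multi_indices" "v \<in> odd_indices"
  shows "i \<in> Y0 \<Longrightarrow> pmult (mono_deriv i \<alpha> u) (xmono \<beta> v)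
      = (if \<alpha> i = 0 then 0 else mono_mult (\<alpha> - unit_index i) u \<beta> v)"
    and "i \<in> Y0 \<Longrightarrow> pmult (xmono \<alpha> u) (mono_deriv i \<beta> v)
      = (if \<beta> i = 0 then 0 else mono_mult \<alpha> u (\<beta> - unit_index i) v)"
    and "i \<in> Y1 \<Longrightarrow> pmult (mono_deriv i \<alpha> u) (xmono \<beta> v)
      = (if i \<in> u then pscale ((-1) ^ card {k \<in> u. k < i}) (mono_mult \<alpha> (u - {i}) \<beta> v) else 0)"
    and "i \<in> Y1 \<Longrightarrow> pmult (xmono \<alpha> u) (mono_deriv i \<beta> v)
      = (if i \<in> v then pscale ((-1) ^ card {k \<in> v. k < i}) (mono_mult \<alpha> u \<beta> (v - {i})) else 0)"
proof -
  have "u - {i} \<in> odd_indices" "v - {i} \<in> odd_indices"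
    using assms by (auto simp: odd_indices_def)
  then show "i \<in> Y0 \<Longrightarrow> pmult (mono_deriv i \<alpha> u) (xmono \<beta> v)
      = (if \<alpha> i = 0 then 0 else mono_mult (\<alpha> - unit_index i) u \<beta> v)"
    and "i \<in> Y0 \<Longrightarrow> pmult (xmono \<alpha> u) (mono_deriv i \<beta> v)
      = (if \<beta> i = 0 then 0 else mono_mult \<alpha> u (\<beta> - unit_index i) v)"
    and "i \<in> Y1 \<Longrightarrow> pmult (mono_deriv i \<alpha> u) (xmono \<beta> v)
      = (if i \<in> u then pscale ((-1) ^ card {k \<in> u. k < i}) (mono_mult \<alpha> (u - {i}) \<beta> v) else 0)"
    and "i \<in> Y1 \<Longrightarrow> pmult (xmono \<alpha> u) (mono_deriv i \<beta> v)
      = (if i \<in> v then pscale ((-1) ^ card {k \<in> v. k < i}) (mono_mult \<alpha> u \<beta> (v - {i})) else 0)"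
    using assms Y1_not_Y0
    by (simp_all add: mono_deriv_def pmult_linear_left pmult_linear_right pmult_xmono minus_unit_multi)
qed

lemma pd_pmult_odd:
  assumes "i \<in> Y1" "a \<in> carrier_O" "has_parity s a" "b \<in> carrier_O"
  shows "pd i (pmult a b) = pmult (pd i a) b + pscale ((-1) ^ s) (pmult a (pd i b :: 'f::field superpoly))"
proof (rule carrier_O_induct[OF assms(2),
      where P = "\<lambda>x. pd i (pmult x b) = pmult (pd i x) b + pscale ((-1) ^ s) (pmult x (pd i b))"])
  fix \<alpha> u
  assume u: "\<alpha> \<in> multi_indices" "u \<in> odd_indices" and "a \<alpha> u \<noteq> 0"
  then have "card u mod 2 = s"
    using assms by (auto simp: has_parity_def)
  then have s: "(-1) ^ s = ((-1) ^ card u :: 'f)"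
    by (intro minus_one_power_cong) auto
  show "pd i (pmult (xmono \<alpha> u) b) = pmult (pd i (xmono \<alpha> u)) b + pscale ((-1) ^ s) (pmult (xmono \<alpha> u) (pd i b))"
  proof (rule carrier_O_induct[OF assms(4), where P = "\<lambda>x. pd i (pmult (xmono \<alpha> u) x)
        = pmult (pd i (xmono \<alpha> u)) x + pscale ((-1) ^ s) (pmult (xmono \<alpha> u) (pd i x))"])
    fix \<beta> v
    assume v: "\<beta> \<in> multi_indices" "v \<in> odd_indices"
    show "pd i (pmult (xmono \<alpha> u) (xmono \<beta> v)) = pmult (pd i (xmono \<alpha> u)) (xmono \<beta> v)
        + pscale ((-1) ^ s) (pmult (xmono \<alpha> u) (pd i (xmono \<beta> v) :: 'f superpoly))"
      using u v pd_mono_mult_odd[OF assms(1) u(2) v(2), of \<alpha> \<beta>]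
      by (simp only: pmult_xmono pd_xmono pmult_mono_deriv(3,4)[OF u v assms(1)] s)
  qed (simp_all add: pmult_linear_right pmult_linear_left pd_linear pscale_add ac_simps)
qed (simp_all add: pmult_linear_right pmult_linear_left pd_linear pscale_add ac_simps)

section \<open>Even vector fields and the Poisson bracket\<close>

definition even_O :: "'f::field superpoly set" where
  "even_O = {a \<in> carrier_O. has_parity 0 a}"

text \<open>A vector field as a derivation of the superalgebra.\<close>

definition act :: "'f::field vfield \<Rightarrow> 'f superpoly \<Rightarrow> 'f superpoly" where
  "act X a = (\<Sum>i\<in>Y. pmult (X i) (pd i a))"

text \<open>This is the Poisson bracket \<open>{a, b}\<close> when both elements are even.\<close>

definition poisson :: "'f::field superpoly \<Rightarrow> 'f superpoly \<Rightarrow> 'f superpoly" where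
  "poisson a b = act (DH a) b"

lemma \<mu>_simps [simp]: "i \<in> Y0 \<Longrightarrow> \<mu> i = 0" "i \<in> Y1 \<Longrightarrow> \<mu> i = 1"
  using Y1_not_Y0 by (auto simp: \<mu>_def)

lemma \<mu>_cases: "\<mu> i = 0 \<or> \<mu> i = 1"
  by (simp add: \<mu>_def)

lemma even_O_closed [simp, intro]:
  "0 \<in> even_O"
  "a \<in> even_O \<Longrightarrow> b \<in> even_O \<Longrightarrow> a + b \<in> even_O"
  "a \<in> even_O \<Longrightarrow> pscale c a \<in> even_O"
  by (simp_all add: even_O_def has_parity_closed)

lemma even_O_sum: "(\<And>i. i \<in> A \<Longrightarrow> f i \<in> even_O) \<Longrightarrow> (\<Sum>i\<in>A. f i) \<in> even_O"
  by (induction A rule: infinite_finite_induct) auto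

lemma xmono_even_O: "\<alpha> \<in> multi_indices \<Longrightarrow> u \<in> even_odd_indices \<Longrightarrow> xmono \<alpha> u \<in> even_O"
  by (auto simp: even_O_def even_odd_indices_def intro!: has_parity_xmono)

lemma even_WD:
  assumes "X \<in> even_W"
  shows "X i \<in> carrier_O" "has_parity (\<mu> i) (X i)" "i \<notin> Y \<Longrightarrow> X i = 0"
proof -
  have X: "\<forall>i\<in>Y. X i \<in> carrier_O \<and> has_parity (\<mu> i) (X i)" "\<forall>i. i \<notin> Y \<longrightarrow> X i = 0"
    using assms by (auto simp: even_W_def carrier_W_def has_parity_iff)
  then show "X i \<in> carrier_O" "has_parity (\<mu> i) (X i)"
    by (cases "i \<in> Y"; simp add: has_parity_closed)+
  show "i \<notin> Y \<Longrightarrow> X i = 0"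
    using X by simp
qed

lemma even_WI:
  assumes "\<And>i. i \<in> Y \<Longrightarrow> X i \<in> carrier_O" "\<And>i. i \<in> Y \<Longrightarrow> has_parity (\<mu> i) (X i)" "\<And>i. i \<notin> Y \<Longrightarrow> X i = 0"
  shows "X \<in> even_W"
  using assms by (simp add: even_W_def carrier_W_def has_parity_iff)

lemma zero_even_W: "0 \<in> even_W"
  by (rule even_WI) (simp_all add: has_parity_closed)

lemma act_linear:
  "act X (a + b) = act X a + act X b"
  "act X (pscale c a) = pscale c (act X a)"
  "act X 0 = 0"
  "act X (- a) = - act X a"
  by (simp_all add: act_def pmult_linear_right pd_linear sum.distrib pscale_sum sum_negf)

text \<open>For even vector fields every sign in the definition of the bracket is \<open>+1\<close>, and the bracket
  is the commutator of derivations.\<close>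

lemma bracket_even:
  fixes X Z :: "'f::field vfield"
  assumes "X \<in> even_W" "Z \<in> even_W"
  shows "bracket X Z j = act X (Z j) - act Z (X j)"
proof -
  have zero: "mono_bracket r 0 i s b l = 0" "mono_bracket r a i s 0 l = 0" for r i s l and a b :: "'f superpoly"
    by (simp_all add: mono_bracket_def pmult_linear_left pmult_linear_right pd_linear vmono_def fun_eq_iff)
  have summand: "(\<Sum>r\<in>{0, 1}. \<Sum>s\<in>{0, 1}. mono_bracket r (parity_part r (X i)) i s (parity_part s (Z l)) l)
      = vmono (pmult (X i) (pd i (Z l))) l - vmono (pmult (Z l) (pd l (X i))) i" for i l
  proof -
    note parity_part = parity_part_eq[OF even_WD(2)[OF assms(1)]] parity_part_eq[OF even_WD(2)[OF assms(2)]]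
    have "(\<Sum>r\<in>{0, 1}. \<Sum>s\<in>{0, 1}. mono_bracket r (parity_part r (X i)) i s (parity_part s (Z l)) l)
        = mono_bracket (\<mu> i) (X i) i (\<mu> l) (Z l) l"
      using \<mu>_cases[of i] \<mu>_cases[of l] by (elim disjE; simp add: parity_part zero)
    moreover have "(-1) ^ ((\<mu> i + \<mu> i) * (\<mu> l + \<mu> l)) = (1 :: 'f)"
      by simp
    ultimately show ?thesis
      by (simp only: mono_bracket_def vfield.scale_one)
  qed
  have "bracket X Z j = (\<Sum>i\<in>Y. \<Sum>l\<in>Y. (if j = l then pmult (X i) (pd i (Z l)) else 0)
      - (if j = i then pmult (Z l) (pd l (X i)) else 0))"
    unfolding bracket_def summand by (simp add: sum_fun_apply vmono_apply)
  also have "\<dots> = (if j \<in> Y then act X (Z j) - act Z (X j) else 0)"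
  proof -
    have "(\<Sum>i\<in>Y. \<Sum>l\<in>Y. if j = l then pmult (X i) (pd i (Z l)) else 0) = (if j \<in> Y then act X (Z j) else 0)"
      by (simp add: act_def)
    moreover have "(\<Sum>i\<in>Y. \<Sum>l\<in>Y. if j = i then pmult (Z l) (pd l (X i)) else 0) = (if j \<in> Y then act Z (X j) else 0)"
      by (subst sum.swap) (simp add: act_def)
    ultimately show ?thesis
      by (simp add: sum_subtractf)
  qed
  also have "\<dots> = act X (Z j) - act Z (X j)"
    using even_WD(3)[OF assms(1)] even_WD(3)[OF assms(2)] by (simp add: act_linear)
  finally show ?thesis .
qed

lemma prime_index_in:
  "i \<in> Y0 \<Longrightarrow> prime_index i \<in> Y0" "i \<in> Y1 \<Longrightarrow> prime_index i = i" "i \<in> Y \<Longrightarrow> prime_index i \<in> Y"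
  by (auto simp: prime_index_def Y0_def Y1_def Y_def)

lemma prime_index_involution [simp]: "i \<in> Y \<Longrightarrow> prime_index (prime_index i) = i"
  by (auto simp: prime_index_def Y0_def Y1_def Y_def)

lemma bij_prime_index: "bij_betw prime_index Y Y" "bij_betw prime_index Y0 Y0"
proof -
  show "bij_betw prime_index Y Y"
    by (rule bij_betw_byWitness[where f' = prime_index]) (auto simp: prime_index_in)
  show "bij_betw prime_index Y0 Y0"
    by (rule bij_betw_byWitness[where f' = prime_index]) (auto simp: prime_index_in Y_def)
qed

lemma \<mu>_prime_index [simp]: "i \<in> Y \<Longrightarrow> \<mu> (prime_index i) = \<mu> i"
  by (auto simp: Y_def prime_index_in)

text \<open>The Poisson structure is antisymmetric in the even variables and symmetric in the odd ones.
  Together with the sign rule for odd elements this makes the Poisson bracket antisymmetric.\<close>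

lemma \<tau>_prime_index: "i \<in> Y \<Longrightarrow> \<tau> (prime_index i) * (-1) ^ \<mu> i = - (\<tau> i :: 'f::field)"
  by (auto simp: Y_def prime_index_def \<tau>_def \<mu>_def Y0_def Y1_def)

lemma DH_even_apply:
  assumes "a \<in> even_O"
  shows "DH a j = (if j \<in> Y then pscale (\<tau> (prime_index j)) (pd (prime_index j) a) else 0)"
proof -
  have "has_parity 0 a"
    using assms by (simp add: even_O_def)
  then have "DH a j = (\<Sum>i\<in>Y. if j = prime_index i then pscale (\<tau> i) (pd i a) else 0)"
    by (simp add: DH_def parity_part_eq pd_linear sum_fun_apply vmono_apply if_distrib cong: if_cong)
  also have "\<dots> = (\<Sum>i\<in>Y. if i = prime_index j then if j \<in> Y then pscale (\<tau> i) (pd i a) else 0 else 0)"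
    by (intro sum.cong) (auto simp: prime_index_in)
  also have "\<dots> = (if j \<in> Y then pscale (\<tau> (prime_index j)) (pd (prime_index j) a) else 0)"
    by (simp add: prime_index_in)
  finally show ?thesis .
qed

lemma DH_linear:
  assumes "a \<in> even_O"
  shows "b \<in> even_O \<Longrightarrow> DH (a + b) = DH a + DH b" "DH (pscale c a) = vscale c (DH a)"
  using assms by (simp_all add: fun_eq_iff[of "DH _"] DH_even_apply pd_linear pscale_add mult.commute)

lemma DH_zero: "DH 0 = 0"
  by (simp add: fun_eq_iff[of "DH _"] DH_even_apply pd_linear)

lemma DH_even_W: "a \<in> even_O \<Longrightarrow> DH a \<in> even_W"
proof (rule even_WI)
  assume a: "a \<in> even_O"
  fix i
  assume i: "i \<in> Y"
  have "has_parity ((0 + \<mu> (prime_index i)) mod 2) (pd (prime_index i) a)"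
    using a i by (intro has_parity_pd) (auto simp: even_O_def prime_index_in)
  moreover have "\<mu> i mod 2 = \<mu> i"
    by (simp add: \<mu>_def)
  ultimately show "has_parity (\<mu> i) (DH a i)"
    using a i by (simp add: DH_even_apply has_parity_closed)
  show "DH a i \<in> carrier_O"
    using a i by (simp add: DH_even_apply prime_index_in)
qed (simp add: DH_even_apply)

lemma poisson_eq:
  "a \<in> even_O \<Longrightarrow> poisson a b = (\<Sum>i\<in>Y. pscale (\<tau> (prime_index i)) (pmult (pd (prime_index i) a) (pd i b)))"
  by (simp add: poisson_def act_def DH_even_apply pmult_linear_left)

lemma poisson_even_O:
  assumes "a \<in> even_O" "b \<in> even_O"
  shows "poisson a b \<in> even_O"
proof -
  have "pmult (pd (prime_index i) a) (pd i b) \<in> even_O" if i: "i \<in> Y" for i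
  proof -
    have "has_parity ((0 + \<mu> (prime_index i)) mod 2) (pd (prime_index i) a)"
      "has_parity ((0 + \<mu> i) mod 2) (pd i b)"
      using assms i by (intro has_parity_pd; auto simp: even_O_def prime_index_in)+
    from has_parity_pmult[OF _ this(1) _ this(2)] show ?thesis
      using i \<mu>_cases[of i] by (auto simp: even_O_def prime_index_in)
  qed
  then show ?thesis
    unfolding poisson_eq[OF assms(1)]
    by (intro even_O_sum even_O_closed(3))
qed

lemma pmult_support:
  assumes "pmult a b \<gamma> w \<noteq> 0"
  obtains \<alpha> u \<beta> v where "a \<alpha> u \<noteq> 0" "b \<beta> v \<noteq> 0" "u \<union> v = w" "u \<inter> v = {}" "u \<in> odd_indices" "v \<in> odd_indices"
proof -
  have "(\<Sum>\<alpha>\<in>multi_indices. \<Sum>u\<in>odd_indices. a \<alpha> u * linear_ext (mono_mult \<alpha> u) b \<gamma> w) \<noteq> 0"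
    using assms by (simp add: pmult_def linear_ext_apply[of _ a])
  then obtain \<alpha> where "(\<Sum>u\<in>odd_indices. a \<alpha> u * linear_ext (mono_mult \<alpha> u) b \<gamma> w) \<noteq> 0"
    by (rule sum.not_neutral_contains_not_neutral)
  then obtain u where u: "u \<in> odd_indices" "a \<alpha> u * linear_ext (mono_mult \<alpha> u) b \<gamma> w \<noteq> 0"
    by (rule sum.not_neutral_contains_not_neutral)
  then have "(\<Sum>\<beta>\<in>multi_indices. \<Sum>v\<in>odd_indices. b \<beta> v * mono_mult \<alpha> u \<beta> v \<gamma> w) \<noteq> 0"
    by (simp add: linear_ext_apply)
  then obtain \<beta> where "(\<Sum>v\<in>odd_indices. b \<beta> v * mono_mult \<alpha> u \<beta> v \<gamma> w) \<noteq> 0"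
    by (rule sum.not_neutral_contains_not_neutral)
  then obtain v where v: "v \<in> odd_indices" "b \<beta> v * mono_mult \<alpha> u \<beta> v \<gamma> w \<noteq> 0"
    by (rule sum.not_neutral_contains_not_neutral)
  then have "u \<union> v = w" "u \<inter> v = {}"
    by (auto simp: mono_mult_eq xmono_apply split: if_splits)
  then show ?thesis
    using that[of \<alpha> u \<beta> v] u v by simp
qed

text \<open>An odd derivative of an even element is odd, so each of its monomials contains an odd
  variable.\<close>

lemma pd_odd_support:
  assumes "i \<in> Y1" "a \<in> even_O" "pd i a \<alpha> u \<noteq> 0"
  shows "i \<notin> u" "u \<noteq> {}"
proof -
  show "i \<notin> u"
    using assms by (auto simp: pd_odd_apply split: if_splits)
  have "has_parity ((0 + \<mu> i) mod 2) (pd i a)"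
    using assms by (intro has_parity_pd) (auto simp: even_O_def Y_def)
  then have "card u mod 2 = 1"
    using assms by (simp add: has_parity_def)
  then show "u \<noteq> {}"
    by auto
qed

text \<open>The derivatives of \<open>x\<^sup>\<omega>\<close> in the even variables vanish.  For an odd index \<open>i\<close>, each monomial of
  \<open>pd i a\<close> contains an odd variable other than \<open>x\<^sub>i\<close>, and \<open>pd i x\<^sup>\<omega>\<close> already contains all of
  these.\<close>

lemma poisson_xmono_omega:
  assumes a: "a \<in> even_O"
  shows "(poisson a (xmono 0 \<omega>) :: 'f::field superpoly) = 0"
proof -
  have omega: "\<omega> \<in> odd_indices"
    by (simp add: odd_indices_def \<omega>_def)
  have "pmult (pd (prime_index i) a) (pd i (xmono 0 \<omega>)) = 0" if "i \<in> Y0" for i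
    using that omega zero_multi by (simp add: pd_xmono mono_deriv_def pmult_linear_right)
  moreover have "pmult (pd i a) (pd i (xmono 0 \<omega>)) = 0" if i: "i \<in> Y1" for i
  proof (rule ccontr)
    assume "pmult (pd i a) (pd i (xmono 0 \<omega>)) \<noteq> 0"
    then obtain \<gamma> w where "pmult (pd i a) (pd i (xmono 0 \<omega>)) \<gamma> w \<noteq> 0"
      by (auto simp: fun_eq_iff)
    then obtain \<alpha> u \<beta> v where uv: "pd i a \<alpha> u \<noteq> 0" "pd i (xmono 0 \<omega> :: 'f superpoly) \<beta> v \<noteq> 0"
      "u \<inter> v = {}" "u \<in> odd_indices"
      by (rule pmult_support)
    then have "insert i v = \<omega>"
      using i by (auto simp: pd_odd_apply xmono_apply split: if_splits)
    then show False
      using uv pd_odd_support[OF i a uv(1)] by (auto simp: odd_indices_def \<omega>_def)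
  qed
  ultimately show ?thesis
    unfolding poisson_eq[OF a] by (intro sum.neutral) (auto simp: Y_def prime_index_in)
qed

end

section \<open>The even Leibniz rule in positive characteristic\<close>

text \<open>The type argument fixes the coefficient field, on whose characteristic the even Leibniz rule
  depends.\<close>

locale hamiltonian_field = hamiltonian m n p t
  for m n p :: nat and t :: "nat \<Rightarrow> nat" +
  fixes field_type :: "'f::field itself"
  assumes char: "CHAR('f) = p"
    and p_gt: "p > 3" and m_gt: "m > 1" and n_gt: "n > 3"
    and t_pos: "\<forall>i\<in>{1..2 * m}. t i > 0"
begin

lemma prime_p: "prime p"
  using prime_CHAR_semidom[where ?'a = 'f] char p_gt by simp

text \<open>Here \<open>a + b\<close> is \<open>p ^ t i\<close>, the first exponent that the truncation forbids.\<close>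

lemma choose_overflow:
  assumes "i \<in> Y0" "0 < a" "a \<le> top_index i" "a + b = Suc (top_index i)"
  shows "of_nat ((a + b) choose a) = (0 :: 'f)"
proof -
  have "top_index i = p ^ t i - 1" "p ^ t i > 0"
    using assms(1) p_gt by (simp_all add: top_index_def)
  then have "p dvd (p ^ t i choose a)" "a + b = p ^ t i"
    using assms by (auto intro!: prime_dvd_choose_power prime_p)
  then show ?thesis
    using char by (simp add: of_nat_eq_0_iff_char_dvd)
qed

lemma multi_choose_split:
  "i \<in> Y0 \<Longrightarrow> multi_choose \<alpha> \<beta> = ((\<alpha> i + \<beta> i) choose \<alpha> i) * (\<Prod>j\<in>Y0 - {i}. (\<alpha> j + \<beta> j) choose \<alpha> j)"
  unfolding multi_choose_def by (simp add: prod.remove)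

lemma multi_le_top: "\<alpha> \<in> multi_indices \<Longrightarrow> i \<in> Y0 \<Longrightarrow> \<alpha> i \<le> top_index i"
  by (auto simp: multi_indices_def)

text \<open>This is Pascal's rule.  At the edge of the truncation, where the product vanishes but both
  products with a differentiated factor survive, the two terms add up to a multiple of a binomial
  coefficient of \<open>p ^ t i\<close>, which vanishes in characteristic \<open>p\<close>.\<close>

lemma pd_mono_mult_even:
  assumes i: "i \<in> Y0"
    and "\<alpha> \<in> multi_indices" "u \<in> odd_indices" "\<beta> \<in> multi_indices" "v \<in> odd_indices"
  shows "pd i (mono_mult \<alpha> u \<beta> v :: 'f superpoly)
    = (if \<alpha> i = 0 then 0 else mono_mult (\<alpha> - unit_index i) u \<beta> v)
      + (if \<beta> i = 0 then 0 else mono_mult \<alpha> u (\<beta> - unit_index i) v)"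
proof (cases "u \<inter> v = {}")
  case False
  then show ?thesis
    by (simp add: mono_mult_eq pd_linear)
next
  case disjoint: True
  define q where "q = (\<Prod>j\<in>Y0 - {i}. (\<alpha> j + \<beta> j) choose \<alpha> j)"
  have q_left: "(\<Prod>j\<in>Y0 - {i}. ((\<alpha> - unit_index i) j + \<beta> j) choose (\<alpha> - unit_index i) j) = q"
    and q_right: "(\<Prod>j\<in>Y0 - {i}. (\<alpha> j + (\<beta> - unit_index i) j) choose \<alpha> j) = q"
    unfolding q_def by (auto intro!: prod.cong simp: unit_index_def)
  have choose: "multi_choose \<alpha> \<beta> = ((\<alpha> i + \<beta> i) choose \<alpha> i) * q"
    "multi_choose (\<alpha> - unit_index i) \<beta> = ((\<alpha> i - 1 + \<beta> i) choose (\<alpha> i - 1)) * q"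
    "multi_choose \<alpha> (\<beta> - unit_index i) = ((\<alpha> i + (\<beta> i - 1)) choose \<alpha> i) * q"
    using q_left q_right by (simp_all add: multi_choose_split[OF i] q_def unit_index_def)
  have Un: "u \<union> v \<in> odd_indices"
    using assms by (simp add: odd_indices_Un)
  define \<gamma> where "\<gamma> = \<alpha> + \<beta> - unit_index i"
  have left: "\<alpha> - unit_index i + \<beta> = \<gamma>" if "\<alpha> i \<noteq> 0"
    using that by (auto simp: \<gamma>_def fun_eq_iff unit_index_def)
  have right: "\<alpha> + (\<beta> - unit_index i) = \<gamma>" if "\<beta> i \<noteq> 0"
    using that by (auto simp: \<gamma>_def fun_eq_iff unit_index_def)
  have in_multi: "\<alpha> + \<beta> \<in> multi_indices \<longleftrightarrow> \<gamma> \<in> multi_indices \<and> \<alpha> i + \<beta> i \<le> top_index i"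
  proof
    show "\<alpha> + \<beta> \<in> multi_indices \<Longrightarrow> \<gamma> \<in> multi_indices \<and> \<alpha> i + \<beta> i \<le> top_index i"
      using i minus_unit_multi[of "\<alpha> + \<beta>" i] multi_le_top[of "\<alpha> + \<beta>" i] by (simp add: \<gamma>_def)
  next
    assume *: "\<gamma> \<in> multi_indices \<and> \<alpha> i + \<beta> i \<le> top_index i"
    have eq: "(\<alpha> + \<beta>) j = \<gamma> j" if "j \<noteq> i" for j
      using that by (simp add: \<gamma>_def unit_index_def)
    have "(\<alpha> + \<beta>) j \<le> top_index j" if "j \<in> Y0" for j
      using eq[of j] * multi_le_top[OF _ that, of \<gamma>] by (cases "j = i") auto
    moreover have "(\<alpha> + \<beta>) j = 0" if "j \<notin> Y0" for j
      using eq[of j] * that i by (auto simp: multi_indices_def)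
    ultimately show "\<alpha> + \<beta> \<in> multi_indices"
      unfolding multi_indices_def by blast
  qed
  have deriv: "pd i (xmono (\<alpha> + \<beta>) (u \<union> v) :: 'f superpoly) = xmono \<gamma> (u \<union> v)"
    if "\<gamma> \<in> multi_indices" "\<alpha> i + \<beta> i \<le> top_index i" "\<alpha> i + \<beta> i \<noteq> 0"
    using that in_multi Un i by (auto simp: pd_xmono mono_deriv_def \<gamma>_def)
  consider "\<alpha> i = 0" "\<beta> i = 0" | "\<alpha> i = 0" "\<beta> i \<noteq> 0" | "\<alpha> i \<noteq> 0" "\<beta> i = 0"
    | "\<alpha> i \<noteq> 0" "\<beta> i \<noteq> 0" "\<alpha> i + \<beta> i \<le> top_index i"
    | "\<alpha> i \<noteq> 0" "\<beta> i \<noteq> 0" "\<alpha> i + \<beta> i > top_index i" "\<gamma> \<in> multi_indices"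
    | "\<alpha> i \<noteq> 0" "\<beta> i \<noteq> 0" "\<gamma> \<notin> multi_indices"
    by linarith
  then show ?thesis
  proof cases
    case 1
    then show ?thesis
      using i Un by (auto simp: mono_mult_eq pd_linear pd_xmono mono_deriv_def)
  next
    case 2
    have "\<beta> i \<le> top_index i"
      using assms multi_le_top by blast
    then show ?thesis
      using 2 disjoint right by (simp add: mono_mult_eq in_multi deriv choose pd_linear)
  next
    case 3
    have "\<alpha> i \<le> top_index i"
      using assms multi_le_top by blast
    then show ?thesis
      using 3 disjoint left by (simp add: mono_mult_eq in_multi deriv choose pd_linear)
  next
    case 4
    then obtain a b where ab: "\<alpha> i = Suc a" "\<beta> i = Suc b"
      by (auto simp: gr0_conv_Suc not0_implies_Suc)
    have "(\<alpha> i + \<beta> i) choose \<alpha> i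
        = ((\<alpha> i - 1 + \<beta> i) choose (\<alpha> i - 1)) + ((\<alpha> i + (\<beta> i - 1)) choose \<alpha> i)"
      by (simp add: ab)
    then show ?thesis
      using 4 disjoint left right
      by (simp add: mono_mult_eq in_multi deriv choose pd_linear distrib_right pscale_add_left)
  next
    case 5
    obtain a b where ab: "\<alpha> i = Suc a" "\<beta> i = Suc b"
      using 5 by (auto simp: gr0_conv_Suc not0_implies_Suc)
    have "\<gamma> i \<le> top_index i" "\<alpha> i \<le> top_index i"
      using 5 assms multi_le_top by blast+
    then have "\<alpha> i + \<beta> i = Suc (top_index i)"
      using 5 by (simp add: \<gamma>_def unit_index_def)
    then have "of_nat ((\<alpha> i + \<beta> i) choose \<alpha> i) = (0 :: 'f)"
      using 5 \<open>\<alpha> i \<le> top_index i\<close> by (intro choose_overflow[OF i]) auto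
    then have "of_nat ((a + Suc b) choose a) + of_nat ((Suc a + b) choose Suc a) = (0 :: 'f)"
      by (simp add: ab)
    then have "pscale (of_nat ((a + Suc b) choose a) * c) x + pscale (of_nat ((Suc a + b) choose Suc a) * c) x = 0"
      for c :: 'f and x
      by (simp add: pscale_add_left[symmetric] distrib_right[symmetric])
    then show ?thesis
      using 5 ab disjoint left right
      by (simp add: mono_mult_eq in_multi choose pd_linear mult.assoc)
  next
    case 6
    then show ?thesis
      using left right by (simp add: mono_mult_eq in_multi pd_linear)
  qed
qed

lemma pd_pmult_even:
  assumes "i \<in> Y0" "a \<in> carrier_O" "b \<in> carrier_O"
  shows "pd i (pmult a b) = pmult (pd i a) b + pmult a (pd i b :: 'f superpoly)"
proof (rule carrier_O_induct[OF assms(2), where P = "\<lambda>x. pd i (pmult x b) = pmult (pd i x) b + pmult x (pd i b)"])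
  fix \<alpha> u
  assume u: "\<alpha> \<in> multi_indices" "u \<in> odd_indices"
  show "pd i (pmult (xmono \<alpha> u) b) = pmult (pd i (xmono \<alpha> u)) b + pmult (xmono \<alpha> u) (pd i b)"
  proof (rule carrier_O_induct[OF assms(3),
        where P = "\<lambda>x. pd i (pmult (xmono \<alpha> u) x) = pmult (pd i (xmono \<alpha> u)) x + pmult (xmono \<alpha> u) (pd i x)"])
    fix \<beta> v
    assume v: "\<beta> \<in> multi_indices" "v \<in> odd_indices"
    show "pd i (pmult (xmono \<alpha> u) (xmono \<beta> v))
        = pmult (pd i (xmono \<alpha> u)) (xmono \<beta> v) + pmult (xmono \<alpha> u) (pd i (xmono \<beta> v) :: 'f superpoly)"
      using u v pd_mono_mult_even[OF assms(1) u v]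
      by (simp add: pmult_xmono pd_xmono pmult_mono_deriv(1,2)[OF u v assms(1)])
  qed (simp_all add: pmult_linear_right pmult_linear_left pd_linear pscale_add ac_simps)
qed (simp_all add: pmult_linear_right pmult_linear_left pd_linear pscale_add ac_simps)

lemma pd_pmult:
  assumes "i \<in> Y" "a \<in> carrier_O" "has_parity s a" "b \<in> carrier_O"
  shows "pd i (pmult a b) = pmult (pd i a) b + pscale ((-1) ^ (\<mu> i * s)) (pmult a (pd i b :: 'f superpoly))"
  using assms pd_pmult_even[of i a b] pd_pmult_odd[of i a s b] Y1_not_Y0
  by (auto simp: Y_def \<mu>_def)

section \<open>Brackets of Hamiltonian fields\<close>

text \<open>The components of both sides are compared.  A component of the right-hand side is a derivative
  \<open>pd k {a, b}\<close> up to a constant; by the Leibniz rule it is a sum of two parts.  One of them is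
  \<open>{a, pd k b}\<close> because \<open>pd k\<close> commutes with the derivations in the bracket up to a sign that the
  Leibniz rule compensates; the other is \<open>- {b, pd k a}\<close> by supercommutativity and the symmetry of
  \<open>\<tau>\<close>.\<close>

lemma DH_bracket:
  assumes a: "a \<in> even_O" and b: "b \<in> even_O"
  shows "bracket (DH a) (DH b) = DH (poisson a b :: 'f superpoly)"
proof
  fix j
  show "bracket (DH a) (DH b) j = DH (poisson a b) j"
  proof (cases "j \<in> Y")
    case False
    then show ?thesis
      using assms by (simp add: bracket_even DH_even_W DH_even_apply poisson_even_O act_linear)
  next
    case j: True
    define k where "k = prime_index j"
    have k: "k \<in> Y"
      using j by (simp add: k_def prime_index_in)
    have carrier: "a \<in> carrier_O" "b \<in> carrier_O" and parity: "has_parity 0 a" "has_parity 0 b"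
      using assms by (auto simp: even_O_def)
    have pd_parity: "has_parity (\<mu> i) (pd i c)" if "i \<in> Y" "c \<in> even_O" for i and c :: "'f superpoly"
      using that has_parity_pd[of 0 c i] \<mu>_cases[of i] by (auto simp: even_O_def)
    (* pd k of the Poisson bracket is S + T: S collects the terms where pd k hits the derivative
       of a, T those where it hits the derivative of b *)
    define S where "S = (\<Sum>i\<in>Y. pscale (\<tau> (prime_index i)) (pmult (pd k (pd (prime_index i) a)) (pd i b)))"
    define T where "T = (\<Sum>i\<in>Y. pscale (\<tau> (prime_index i)) (pmult (pd (prime_index i) a) (pd i (pd k b))))"
    have Leibniz: "pd k (pmult (pd (prime_index i) a) (pd i b))
        = pmult (pd k (pd (prime_index i) a)) (pd i b) + pmult (pd (prime_index i) a) (pd i (pd k b))"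
      if i: "i \<in> Y" for i
    proof -
      have product: "pd k (pmult (pd (prime_index i) a) (pd i b))
        = pmult (pd k (pd (prime_index i) a)) (pd i b)
          + pscale ((-1) ^ (\<mu> k * \<mu> (prime_index i))) (pmult (pd (prime_index i) a) (pd k (pd i b)))"
        using i by (intro pd_pmult pd_parity k a pd_carrier) (auto simp: prime_index_in)
      have commute: "pd k (pd i b) = pscale ((-1) ^ (\<mu> k * \<mu> i)) (pd i (pd k b))"
        using i k by (intro pd_commute)
      show ?thesis
        unfolding product commute using i by (simp add: pmult_linear_right power_mult_distrib[symmetric])
    qed
    have antisymmetric: "pscale (\<tau> (prime_index i)) (pmult (pd k (pd (prime_index i) a)) (pd i b))
        = pscale (- \<tau> i) (pmult (pd i b) (pd (prime_index i) (pd k a)))" if i: "i \<in> Y" for i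
    proof -
      have "has_parity ((\<mu> k + \<mu> i) mod 2) (pd (prime_index i) (pd k a))"
        using i k has_parity_pd[OF pd_parity[OF k a], of "prime_index i"] by (simp add: prime_index_in)
      then have "pmult (pd (prime_index i) (pd k a)) (pd i b)
          = pscale ((-1) ^ ((\<mu> k + \<mu> i) mod 2 * \<mu> i)) (pmult (pd i b) (pd (prime_index i) (pd k a)))"
        using i b by (intro pmult_supercommute pd_parity pd_carrier) (auto simp: prime_index_in)
      moreover have "pd k (pd (prime_index i) a) = pscale ((-1) ^ (\<mu> k * \<mu> i)) (pd (prime_index i) (pd k a))"
        using i k pd_commute[of k "prime_index i" a] by (simp add: prime_index_in)
      moreover have "(-1) ^ (\<mu> k * \<mu> i) * (-1) ^ ((\<mu> k + \<mu> i) mod 2 * \<mu> i) = ((-1) ^ \<mu> i :: 'f)"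
        using \<mu>_cases[of i] \<mu>_cases[of k] by (elim disjE; simp)
      ultimately show ?thesis
        using \<tau>_prime_index[OF i, where ?'f = 'f] by (simp add: pmult_linear_left mult.assoc)
    qed
    have "S = (\<Sum>i\<in>Y. pscale (- \<tau> i) (pmult (pd i b) (pd (prime_index i) (pd k a))))"
      unfolding S_def by (intro sum.cong refl antisymmetric)
    also have "\<dots> = (\<Sum>i\<in>Y. pscale (- \<tau> (prime_index i)) (pmult (pd (prime_index i) b)
        (pd (prime_index (prime_index i)) (pd k a))))"
      by (rule sum.reindex_bij_betw[OF bij_prime_index(1), symmetric])
    also have "\<dots> = (\<Sum>i\<in>Y. pscale (- \<tau> (prime_index i)) (pmult (pd (prime_index i) b) (pd i (pd k a))))"
      by (intro sum.cong) simp_all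
    finally have S: "S = (\<Sum>i\<in>Y. pscale (- \<tau> (prime_index i)) (pmult (pd (prime_index i) b) (pd i (pd k a))))" .
    have left: "DH (poisson a b) j = pscale (\<tau> k) (pd k (poisson a b))"
      using j a b by (simp add: DH_even_apply poisson_even_O k_def)
    have sum: "pd k (poisson a b) = S + T"
      unfolding poisson_eq[OF a] pd_sum pd_linear S_def T_def sum.distrib[symmetric]
      by (intro sum.cong refl) (simp add: Leibniz pscale_add)
    have right: "pscale (\<tau> k) (S + T) = bracket (DH a) (DH b) j"
    proof -
      have "pscale (\<tau> k) T = act (DH a) (DH b j)"
        using j a b by (simp add: T_def act_def DH_even_apply pmult_linear_left pmult_linear_right
            pd_linear pscale_sum k_def mult.commute)
      moreover have "pscale (\<tau> k) S = - act (DH b) (DH a j)"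
        unfolding S using j a b by (simp add: act_def DH_even_apply pmult_linear_left pmult_linear_right
            pd_linear pscale_sum k_def mult.commute sum_negf[symmetric] fun_eq_iff[of "sum _ _"] sum_fun_apply)
      ultimately show ?thesis
        using a b by (simp only: pscale_add bracket_even DH_even_W) simp
    qed
    show ?thesis
      unfolding left sum right ..
  qed
qed

lemma two_neq_zero: "(2 :: 'f) \<noteq> 0"
  using char p_gt of_nat_eq_0_iff_char_dvd[where ?'a = 'f, of 2] by (auto dest: dvd_imp_le)

text \<open>This is what makes \<open>\<NN>\<close> an ideal.  In the even variables the Poisson bracket is a divergence:
  \<open>pd i' a * pd i b\<close> is \<open>pd i' (a * pd i b)\<close> minus \<open>a * pd i' (pd i b)\<close>, and the latter terms cancel
  in the sum.  A derivative in an even variable has no component at the top multi-index.  The terms of the odd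
  variables contribute nothing by parity: each of their monomials contains some odd variable, but
  not \<open>x\<^sub>i\<close>.\<close>

lemma poisson_top:
  assumes a: "a \<in> even_O" and b: "b \<in> even_O" and w: "w = {} \<or> w = \<omega>"
  shows "(poisson a b :: 'f superpoly) top_index w = 0"
proof -
  have odd: "pmult (pd i a) (pd i b) top_index w = 0" if i: "i \<in> Y1" for i
  proof (rule ccontr)
    assume "pmult (pd i a) (pd i b) top_index w \<noteq> 0"
    then obtain \<alpha> u \<beta> v where uv: "pd i a \<alpha> u \<noteq> 0" "pd i b \<beta> v \<noteq> 0" "u \<union> v = w"
      by (rule pmult_support)
    then have "i \<notin> w" "w \<noteq> {}"
      using pd_odd_support[OF i a uv(1)] pd_odd_support[OF i b uv(2)] by auto
    then show False
      using w i by (auto simp: \<omega>_def)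
  qed
  have edge: "pd i c top_index w = 0" if "i \<in> Y0" for i and c :: "'f superpoly"
  proof -
    have "top_index + unit_index i \<notin> multi_indices"
      using that by (auto simp: multi_indices_def unit_index_def)
    then show ?thesis
      using that by (simp add: pd_even_apply)
  qed
  have carrier: "a \<in> carrier_O" "b \<in> carrier_O"
    using a b by (auto simp: even_O_def)
  define S where "S = (\<Sum>i\<in>Y0. pscale (\<tau> (prime_index i)) (pmult a (pd (prime_index i) (pd i b))))"
  have Y0: "i \<in> Y" if "i \<in> Y0" for i
    using that by (simp add: Y_def)
  (* the terms of i and i' cancel in pairs: pd i and pd i' commute, and the signs are opposite *)
  have "S = (\<Sum>i\<in>Y0. pscale (\<tau> (prime_index (prime_index i)))
      (pmult a (pd (prime_index (prime_index i)) (pd (prime_index i) b))))"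
    unfolding S_def by (rule sum.reindex_bij_betw[OF bij_prime_index(2), symmetric])
  also have "\<dots> = (\<Sum>i\<in>Y0. pscale (- \<tau> (prime_index i)) (pmult a (pd (prime_index i) (pd i b))))"
  proof (intro sum.cong refl)
    fix i
    assume i: "i \<in> Y0"
    have "pd i (pd (prime_index i) b) = pd (prime_index i) (pd i b)"
      using i pd_commute[of i "prime_index i" b] by (simp add: Y0 prime_index_in)
    moreover have "\<tau> i = - (\<tau> (prime_index i) :: 'f)"
      using i \<tau>_prime_index[where ?'f = 'f, of i] by (simp add: Y0)
    ultimately show "pscale (\<tau> (prime_index (prime_index i)))
          (pmult a (pd (prime_index (prime_index i)) (pd (prime_index i) b)))
        = pscale (- \<tau> (prime_index i)) (pmult a (pd (prime_index i) (pd i b)))"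
      using i by (simp add: Y0)
  qed
  finally have swap: "S = (\<Sum>i\<in>Y0. pscale (- \<tau> (prime_index i)) (pmult a (pd (prime_index i) (pd i b))))" .
  have "S top_index w = - S top_index w"
    by (subst swap) (simp add: S_def sum_fun_apply sum_negf)
  then have "2 * S top_index w = 0"
    by simp
  then have S: "S top_index w = 0"
    using two_neq_zero by simp
  have "pmult (pd (prime_index i) a) (pd i b) top_index w = - pmult a (pd (prime_index i) (pd i b)) top_index w"
    if i: "i \<in> Y0" for i
  proof -
    have "pd (prime_index i) (pmult a (pd i b))
        = pmult (pd (prime_index i) a) (pd i b) + pmult a (pd (prime_index i) (pd i b))"
      using i carrier by (intro pd_pmult_even prime_index_in pd_carrier Y0)
    then show ?thesis
      using edge[OF prime_index_in(1)[OF i], of "pmult a (pd i b)"]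
      by (simp add: eq_neg_iff_add_eq_0)
  qed
  then have even: "(\<Sum>i\<in>Y0. \<tau> (prime_index i) * pmult (pd (prime_index i) a) (pd i b) top_index w) = - S top_index w"
    by (simp add: S_def sum_fun_apply sum_negf)
  have "poisson a b top_index w = (\<Sum>i\<in>Y0. \<tau> (prime_index i) * pmult (pd (prime_index i) a) (pd i b) top_index w)
      + (\<Sum>i\<in>Y1. \<tau> (prime_index i) * pmult (pd (prime_index i) a) (pd i b) top_index w)"
    by (simp add: poisson_eq[OF a] sum_fun_apply Y_def sum.union_disjoint Y0_Y1_disjoint)
  then show ?thesis
    by (simp add: even S odd prime_index_in)
qed

section \<open>Brackets lie in the ideal\<close>

lemma top_multi: "top_index \<in> multi_indices"
  by (simp add: multi_indices_def top_index_def)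

lemma omega_neq: "\<omega> \<noteq> {}"
  using n_gt by (simp add: \<omega>_def Y1_def)

lemma DH_mono_in_NN:
  "\<alpha> \<in> multi_indices \<Longrightarrow> u \<in> even_odd_indices \<Longrightarrow> (\<alpha>, u) \<noteq> (top_index, \<omega>) \<Longrightarrow> (\<alpha>, u) \<noteq> (top_index, {})
    \<Longrightarrow> (DH (xmono \<alpha> u) :: 'f vfield) \<in> \<NN>"
  unfolding \<NN>_def by (rule vfield.span_base) blast

lemma NN_closed:
  "(0 :: 'f vfield) \<in> \<NN>" "x \<in> \<NN> \<Longrightarrow> y \<in> \<NN> \<Longrightarrow> x + y \<in> (\<NN> :: 'f vfield set)"
  "x \<in> \<NN> \<Longrightarrow> vscale c x \<in> (\<NN> :: 'f vfield set)"
  unfolding \<NN>_def by (auto intro: vfield.span_zero vfield.span_add vfield.span_scale)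

lemma DH_in_NN:
  assumes a: "a \<in> even_O" and "a top_index \<omega> = 0" "a top_index {} = 0"
  shows "(DH a :: 'f vfield) \<in> \<NN>"
proof -
  have "a \<in> carrier_O"
    using a by (simp add: even_O_def)
  then have "a \<in> even_O \<and> (DH a :: 'f vfield) \<in> \<NN>"
  proof (rule carrier_O_induct[where P = "\<lambda>a. a \<in> even_O \<and> (DH a :: 'f vfield) \<in> \<NN>"])
    fix \<alpha> u
    assume *: "\<alpha> \<in> multi_indices" "u \<in> odd_indices" "a \<alpha> u \<noteq> 0"
    then have "u \<in> even_odd_indices"
      using a by (auto simp: even_O_def has_parity_def even_odd_indices_def)
    then show "xmono \<alpha> u \<in> even_O \<and> (DH (xmono \<alpha> u) :: 'f vfield) \<in> \<NN>"
      using * assms by (auto intro!: xmono_even_O DH_mono_in_NN)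
  qed (auto simp: DH_zero DH_linear NN_closed)
  then show ?thesis ..
qed

lemma even_H_DH:
  assumes "x \<in> (even_H :: 'f vfield set)"
  obtains a where "a \<in> even_O" "x = DH a"
proof -
  have "even_H \<subseteq> DH ` (even_O :: 'f superpoly set)"
    unfolding even_H_def
  proof (rule vfield.span_minimal)
    show "vfield.subspace (DH ` (even_O :: 'f superpoly set))"
      unfolding vfield.subspace_def
    proof (intro conjI ballI allI)
      show "0 \<in> DH ` (even_O :: 'f superpoly set)"
        by (rule image_eqI[of _ _ 0]) (simp_all add: DH_zero)
      show "x + y \<in> DH ` even_O" if "x \<in> DH ` even_O" "y \<in> DH ` even_O" for x y :: "'f vfield"
        using that DH_linear(1)[symmetric] by auto
      show "vscale c x \<in> DH ` even_O" if "x \<in> DH ` even_O" for c and x :: "'f vfield"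
        using that DH_linear(2)[symmetric] by auto
    qed
  qed (auto intro: xmono_even_O)
  then show ?thesis
    using assms that by blast
qed

lemma bracket_even_H:
  assumes "x \<in> even_H" "y \<in> even_H"
  shows "bracket x y \<in> (\<NN> :: 'f vfield set)"
proof -
  obtain a where "a \<in> even_O" "x = DH a"
    using assms(1) by (rule even_H_DH)
  moreover obtain b where "b \<in> even_O" "y = DH b"
    using assms(2) by (rule even_H_DH)
  ultimately show ?thesis
    by (auto simp: DH_bracket poisson_top poisson_even_O intro!: DH_in_NN)
qed

lemma even_odd_empty: "{} \<in> even_odd_indices"
  by (simp add: even_odd_indices_def odd_indices_def)

lemma NN_subset_even_H: "(\<NN> :: 'f vfield set) \<subseteq> even_H"
  unfolding \<NN>_def even_H_def by (rule vfield.span_mono) blast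

lemma DH_top_even_H: "(DH (xmono top_index {}) :: 'f vfield) \<in> even_H"
  unfolding even_H_def using top_multi even_odd_empty omega_neq
  by (intro vfield.span_base) blast

lemma even_H_decompose:
  assumes "x \<in> (even_H :: 'f vfield set)"
  obtains y k where "y \<in> \<NN>" "x = y + vscale k (DH (xmono top_index {}))"
proof -
  have "even_H \<subseteq> vfield.span (insert (DH (xmono top_index {})) {DH (xmono \<alpha> u) :: 'f vfield | \<alpha> u.
     \<alpha> \<in> multi_indices \<and> u \<in> even_odd_indices \<and> (\<alpha>, u) \<noteq> (top_index, \<omega>) \<and> (\<alpha>, u) \<noteq> (top_index, {})})"
    unfolding even_H_def by (rule vfield.span_mono) blast
  from subsetD[OF this assms] obtain k where "x - vscale k (DH (xmono top_index {})) \<in> \<NN>"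
    unfolding \<NN>_def vfield.span_breakdown_eq by (rule exE)
  from that[OF this, of k] show ?thesis
    by simp
qed

section \<open>Vector fields that commute with the ideal\<close>

definition centralises :: "'f vfield \<Rightarrow> bool" where
  "centralises Z \<longleftrightarrow> Z \<in> even_W \<and> (\<forall>y\<in>\<NN>. bracket y Z = 0)"

lemma top_index_gt: "i \<in> Y0 \<Longrightarrow> top_index i > 2"
proof -
  assume i: "i \<in> Y0"
  then have "t i > 0"
    using t_pos by (simp add: Y0_def)
  then have "p ^ 1 \<le> p ^ t i"
    using p_gt by (intro power_increasing) auto
  then show ?thesis
    using i p_gt by (simp add: top_index_def)
qed

lemma unit_multi:
  assumes "k \<in> Y0"
  shows "unit_index k \<in> multi_indices" "unit_index k + unit_index k \<in> multi_indices"
  using assms top_index_gt[of k] by (auto simp: multi_indices_def unit_index_def)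

text \<open>There is more than one even index, and \<open>top_index\<close> is positive at all of them.\<close>

lemma neq_top:
  assumes "\<And>i. i \<in> Y0 \<Longrightarrow> i \<noteq> k \<Longrightarrow> \<alpha> i = 0"
  shows "\<alpha> \<noteq> top_index"
proof -
  have "1 \<in> Y0" "2 \<in> Y0"
    using m_gt by (auto simp: Y0_def)
  then obtain i where "i \<in> Y0" "i \<noteq> k"
    by (metis num.distinct(1) one_eq_numeral_iff)
  then show ?thesis
    using assms[of i] top_index_gt[of i] by auto
qed

lemma pd_even_variable:
  assumes "k \<in> Y0" "i \<in> Y"
  shows "pd i (xmono (unit_index k) {}) = (if i = k then xmono 0 {} else (0 :: 'f superpoly))"
proof -
  have "unit_index k - unit_index k = (0 :: nat \<Rightarrow> nat)"
    by (simp add: fun_eq_iff)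
  moreover have "unit_index k i = 0 \<longleftrightarrow> i \<noteq> k" for i
    by (simp add: unit_index_def)
  ultimately show ?thesis
    using assms unit_multi empty_odd Y1_not_Y0 by (auto simp: pd_xmono mono_deriv_def Y_def)
qed

lemma pd_even_square:
  assumes "k \<in> Y0" "i \<in> Y"
  shows "pd i (xmono (unit_index k + unit_index k) {})
    = (if i = k then xmono (unit_index k) {} else (0 :: 'f superpoly))"
proof -
  have "unit_index k + unit_index k - unit_index k = unit_index k"
    by (simp add: fun_eq_iff)
  moreover have "(unit_index k + unit_index k) i = 0 \<longleftrightarrow> i \<noteq> k" for i
    by (simp add: unit_index_def)
  ultimately show ?thesis
    using assms unit_multi empty_odd Y1_not_Y0
    by (auto simp: pd_xmono mono_deriv_def Y_def simp del: plus_fun_apply)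
qed

lemma pd_odd_variable:
  assumes "l \<in> Y1" "i \<in> Y"
  shows "pd i (xmono 0 {l}) = (if i = l then xmono 0 {} else (0 :: 'f superpoly))"
proof -
  have below: "{k. k = l \<and> k < l} = {}"
    by auto
  show ?thesis
    using assms zero_multi empty_odd Y1_not_Y0 by (auto simp: pd_xmono mono_deriv_def Y_def below)
qed

lemma pd_pair:
  assumes "i \<in> Y1" "l \<in> Y1" "i < l" "q \<in> Y1" "\<alpha> \<in> multi_indices"
  shows "pd q (xmono \<alpha> {i, l})
    = (if q = i then xmono \<alpha> {l} else if q = l then - xmono \<alpha> {i} else (0 :: 'f superpoly))"
proof -
  have below: "{k. (k = i \<or> k = l) \<and> k < i} = {}" "{k. (k = i \<or> k = l) \<and> k < l} = {i}"
    and remove: "{i, l} - {i} = {l}" "{i, l} - {l} = {i}"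
    using assms(3) by auto
  show ?thesis
    using assms empty_odd Y1_not_Y0 by (auto simp: pd_xmono mono_deriv_def below remove)
qed

lemma pd_pair_even: "i \<in> Y1 \<Longrightarrow> l \<in> Y1 \<Longrightarrow> q \<in> Y0 \<Longrightarrow> pd q (xmono 0 {i, l}) = (0 :: 'f superpoly)"
  using zero_multi empty_odd by (simp add: pd_xmono mono_deriv_def)

lemma pmult_one_right:
  assumes "g \<in> carrier_O" "has_parity s g"
  shows "pmult g (xmono 0 {}) = (g :: 'f superpoly)"
proof -
  have "pmult g (xmono 0 {}) = pscale ((-1) ^ (s * 0)) (pmult (xmono 0 {}) g)"
    using assms zero_multi empty_odd by (intro pmult_supercommute) (auto intro: has_parity_xmono)
  then show ?thesis
    using assms by (simp add: pmult_one_left)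
qed

lemma act_one: "act X (xmono 0 {}) = (0 :: 'f superpoly)"
proof -
  have "pd i (xmono 0 {}) = (0 :: 'f superpoly)" for i
    using zero_multi empty_odd by (simp add: pd_xmono mono_deriv_def)
  then show ?thesis
    by (simp add: act_def pmult_linear_right)
qed

lemma act_single:
  assumes k: "k \<in> Y" and pd: "\<And>i. i \<in> Y \<Longrightarrow> pd i a = (if i = k then c else 0)"
  shows "act X a = (pmult (X k) c :: 'f superpoly)"
proof -
  have "act X a = (\<Sum>i\<in>Y. if i = k then pmult (X i) c else 0)"
    unfolding act_def by (intro sum.cong) (simp_all add: pd pmult_linear_right)
  then show ?thesis
    using k by simp
qed

lemma act_even_variable:
  assumes "Z \<in> even_W" "k \<in> Y0"
  shows "act Z (xmono (unit_index k) {}) = (Z k :: 'f superpoly)"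
  using assms act_single[OF _ pd_even_variable[OF assms(2)], of Z]
    pmult_one_right[OF even_WD(1,2)[OF assms(1)]] by (simp add: Y_def)

lemma act_odd_variable:
  assumes "Z \<in> even_W" "l \<in> Y1"
  shows "act Z (xmono 0 {l}) = (Z l :: 'f superpoly)"
  using assms act_single[OF _ pd_odd_variable[OF assms(2)], of Z]
    pmult_one_right[OF even_WD(1,2)[OF assms(1)]] by (simp add: Y_def)

lemma \<tau>_simps: "\<tau> i \<noteq> (0 :: 'f)" "i \<in> Y1 \<Longrightarrow> \<tau> i = (1 :: 'f)"
  by (auto simp: \<tau>_def Y1_def)

text \<open>Elements with a single nonzero derivative give the simplest test fields: translations and the
  fields \<open>x\<^sub>k \<partial>\<^sub>k\<^sub>'\<close>.\<close>

lemma poisson_single: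
  assumes b: "b \<in> even_O" and k: "k \<in> Y" and pd: "\<And>i. i \<in> Y \<Longrightarrow> pd i b = (if i = k then c else 0)"
  shows "poisson b g = pscale (\<tau> k) (pmult c (pd (prime_index k) g) :: 'f superpoly)"
    and "DH b j = (if j = prime_index k then pscale (\<tau> k) c else 0)"
proof -
  have eq: "prime_index i = k \<longleftrightarrow> i = prime_index k" if "i \<in> Y" for i
    using that k by auto
  have "poisson b g = (\<Sum>i\<in>Y. if i = prime_index k then pscale (\<tau> k) (pmult c (pd i g)) else 0)"
    unfolding poisson_eq[OF b]
    by (intro sum.cong) (auto simp: pd prime_index_in eq pmult_linear_left k)
  then show "poisson b g = pscale (\<tau> k) (pmult c (pd (prime_index k) g))"
    using k by (simp add: prime_index_in)
  show "DH b j = (if j = prime_index k then pscale (\<tau> k) c else 0)"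
    using b k by (auto simp: DH_even_apply pd prime_index_in eq)
qed

text \<open>The condition in the form used below: commuting with the Hamiltonian field of a monomial,
  read off in the component \<open>j\<close>.\<close>

lemma centralises_eq:
  assumes "centralises Z" "\<alpha> \<in> multi_indices" "u \<in> even_odd_indices" "\<alpha> \<noteq> top_index"
  shows "poisson (xmono \<alpha> u) (Z j) = act Z (DH (xmono \<alpha> u) j)"
proof -
  have "(DH (xmono \<alpha> u) :: 'f vfield) \<in> \<NN>"
    using assms by (intro DH_mono_in_NN) auto
  then have "bracket (DH (xmono \<alpha> u)) Z j = 0" and "Z \<in> even_W"
    using assms(1) by (auto simp: centralises_def)
  then show ?thesis
    using assms by (simp add: poisson_def bracket_even DH_even_W xmono_even_O)
qed

text \<open>Commutation with the translation \<open>\<partial>\<^sub>k\<close>, which up to sign is the Hamiltonian field of the even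
  variable conjugate to \<open>x\<^sub>k\<close>.\<close>

lemma centralises_constant:
  assumes Z: "centralises Z" and k: "k \<in> Y0"
  shows "pd k (Z j) = 0"
proof -
  define k' where "k' = prime_index k"
  have k': "k' \<in> Y0" "prime_index k' = k" "k' \<in> Y"
    using k by (auto simp: k'_def prime_index_in Y_def)
  have b: "xmono (unit_index k') {} \<in> (even_O :: 'f superpoly set)"
    using k' unit_multi even_odd_empty by (intro xmono_even_O)
  note single = poisson_single[OF b k'(3) pd_even_variable[OF k'(1)]]
  have "unit_index k' \<noteq> top_index"
    by (rule neq_top[of k']) (simp add: unit_index_def)
  then have "poisson (xmono (unit_index k') {}) (Z j) = act Z (DH (xmono (unit_index k') {}) j)"
    using Z k' unit_multi even_odd_empty by (intro centralises_eq)
  then have "pscale (\<tau> k') (pmult (xmono 0 {}) (pd k (Z j))) = 0"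
    by (simp add: single k' act_linear act_one split: if_splits)
  then have "pscale (\<tau> k') (pd k (Z j)) = 0"
    using k by (simp add: pmult_one_left Y_def)
  then show ?thesis
    by (simp add: \<tau>_simps)
qed

lemma centralises_support_zero:
  assumes Z: "centralises Z" and "Z j \<gamma> w \<noteq> 0"
  shows "\<gamma> = 0"
proof (rule ccontr)
  assume "\<gamma> \<noteq> 0"
  then obtain k where k: "\<gamma> k \<noteq> 0"
    by (auto simp: fun_eq_iff)
  have mem: "\<gamma> \<in> multi_indices" "w \<in> odd_indices"
    using Z carrier_OD[OF even_WD(1), of Z j \<gamma> w] assms(2) by (simp_all add: centralises_def)
  then have "k \<in> Y0"
    using k by (auto simp: multi_indices_def)
  moreover have "\<gamma> - unit_index k + unit_index k = \<gamma>"
    using k by (auto simp: fun_eq_iff unit_index_def)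
  ultimately have "pd k (Z j) (\<gamma> - unit_index k) w = Z j \<gamma> w"
    using mem by (simp add: pd_even_apply)
  then show False
    using assms centralises_constant[OF Z \<open>k \<in> Y0\<close>] by simp
qed

text \<open>Commutation with the field \<open>x\<^sub>k \<partial>\<^sub>k\<^sub>'\<close>, the Hamiltonian field of the divided square of
  \<open>x\<^sub>k\<close>.  It annihilates the components of \<open>Z\<close>, which do not involve even variables, so only \<open>Z\<close>
  applied to \<open>x\<^sub>k\<close> remains.\<close>

lemma centralises_even_component:
  assumes Z: "centralises Z" and k: "k \<in> Y0"
  shows "Z k = 0"
proof -
  have kY: "k \<in> Y"
    using k by (simp add: Y_def)
  have b: "xmono (unit_index k + unit_index k) {} \<in> (even_O :: 'f superpoly set)"
    using k unit_multi even_odd_empty by (intro xmono_even_O)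
  note single = poisson_single[OF b kY pd_even_square[OF k]]
  have "unit_index k + unit_index k \<noteq> top_index"
    by (rule neq_top[of k]) (simp add: unit_index_def)
  then have "poisson (xmono (unit_index k + unit_index k) {}) (Z (prime_index k))
      = act Z (DH (xmono (unit_index k + unit_index k) {}) (prime_index k))"
    using Z k unit_multi even_odd_empty by (intro centralises_eq)
  then have "pscale (\<tau> k) (act Z (xmono (unit_index k) {})) = 0"
    using Z k by (simp add: single centralises_constant prime_index_in pmult_linear_right act_linear)
  then show ?thesis
    using Z k by (simp add: \<tau>_simps act_even_variable centralises_def)
qed

lemma pair_even_odd: "i \<in> Y1 \<Longrightarrow> l \<in> Y1 \<Longrightarrow> i < l \<Longrightarrow> {i, l} \<in> even_odd_indices"
  by (auto simp: even_odd_indices_def odd_indices_def)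

lemma DH_pair:
  assumes "i \<in> Y1" "l \<in> Y1" "i < l"
  shows "DH (xmono 0 {i, l}) i = (xmono 0 {l} :: 'f superpoly)"
    "DH (xmono 0 {i, l}) l = - (xmono 0 {i} :: 'f superpoly)"
  using assms by (simp_all add: DH_even_apply xmono_even_O zero_multi pair_even_odd Y_def prime_index_in
      pd_pair \<tau>_simps)

lemma poisson_pair:
  assumes "i \<in> Y1" "l \<in> Y1" "i < l"
  shows "poisson (xmono 0 {i, l}) g = pmult (xmono 0 {l}) (pd i g) - (pmult (xmono 0 {i}) (pd l g) :: 'f superpoly)"
proof -
  have "poisson (xmono 0 {i, l}) g
      = (\<Sum>q\<in>Y. pscale (\<tau> (prime_index q)) (pmult (pd (prime_index q) (xmono 0 {i, l})) (pd q g)))"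
    using assms by (intro poisson_eq xmono_even_O zero_multi pair_even_odd)
  also have "\<dots> = (\<Sum>q\<in>{i, l}. pscale (\<tau> (prime_index q)) (pmult (pd (prime_index q) (xmono 0 {i, l})) (pd q g)))"
    using assms by (intro sum.mono_neutral_right)
      (auto simp: Y_def prime_index_in pd_pair pd_pair_even zero_multi pmult_linear_left)
  also have "\<dots> = pmult (xmono 0 {l}) (pd i g) + - pmult (xmono 0 {i}) (pd l g)"
    using assms by (simp add: prime_index_in pd_pair zero_multi \<tau>_simps pmult_linear_left)
  finally show ?thesis
    by (simp only: diff_conv_add_uminus)
qed

text \<open>The Hamiltonian field of \<open>x\<^sub>i x\<^sub>l\<close> is an infinitesimal rotation of the odd variables.  It
  replaces one of \<open>x\<^sub>i\<close>, \<open>x\<^sub>l\<close> by the other, up to sign, and kills every monomial that contains both or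
  neither.\<close>

lemma poisson_pair_apply:
  assumes "i \<in> Y1" "l \<in> Y1" "i < l" and w: "w \<in> odd_indices"
  shows "poisson (xmono 0 {i, l}) (g :: 'f superpoly) 0 w
    = (if l \<in> w \<and> i \<notin> w
        then (-1) ^ card {k \<in> w. k < l} * ((-1) ^ card {k \<in> w - {l}. k < i} * g 0 (insert i (w - {l}))) else 0)
    - (if i \<in> w \<and> l \<notin> w
        then (-1) ^ card {k \<in> w. k < i} * ((-1) ^ card {k \<in> w - {i}. k < l} * g 0 (insert l (w - {i}))) else 0)"
proof -
  have "w - {q} \<in> odd_indices" for q
    using w by (auto simp: odd_indices_def)
  moreover have "i \<in> Y" "l \<in> Y"
    using assms by (auto simp: Y_def)
  ultimately show ?thesis
    unfolding poisson_pair[OF assms(1-3)] using assms(1-3) zero_multi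
    by (auto simp: pmult_odd_variable_apply pd_odd_apply)
qed

text \<open>Commutation with the rotation in the variables \<open>x\<^sub>i\<close> and \<open>x\<^sub>l\<close>.\<close>

lemma centralises_pair:
  assumes Z: "centralises Z" and il: "i \<in> Y1" "l \<in> Y1" "i < l"
  shows "poisson (xmono 0 {i, l}) (Z i) = Z l" "poisson (xmono 0 {i, l}) (Z l) = - Z i"
proof -
  have "(0 :: nat \<Rightarrow> nat) \<noteq> top_index"
    by (rule neq_top[of 0]) simp
  then have *: "poisson (xmono 0 {i, l}) (Z j) = act Z (DH (xmono 0 {i, l}) j)" for j
    using Z il by (intro centralises_eq zero_multi pair_even_odd)
  show "poisson (xmono 0 {i, l}) (Z i) = Z l"
    using Z il by (simp add: * DH_pair act_odd_variable centralises_def)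
  show "poisson (xmono 0 {i, l}) (Z l) = - Z i"
    using Z il by (simp add: * DH_pair act_odd_variable act_linear centralises_def fun_eq_iff)
qed

text \<open>Each component \<open>Z j\<close> is, up to sign, a rotation of any other odd component.  A monomial of it
  therefore contains exactly one of \<open>x\<^sub>j\<close> and \<open>x\<^sub>q\<close> for every \<open>q \<noteq> j\<close>, which leaves two
  possibilities.\<close>

lemma centralises_support:
  assumes Z: "centralises Z" and j: "j \<in> Y1" and nz: "Z j \<gamma> w \<noteq> 0"
  shows "\<gamma> = 0" and "w = {j} \<or> w = \<omega> - {j}"
proof -
  show \<gamma>: "\<gamma> = 0"
    using centralises_support_zero[OF Z, of j \<gamma> w] nz by simp
  have w: "w \<in> odd_indices"
    using Z carrier_OD[OF even_WD(1), of Z j \<gamma> w] nz by (simp add: centralises_def)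
  have "(j \<in> w) \<noteq> (q \<in> w)" if q: "q \<in> Y1" "q \<noteq> j" for q
  proof (cases "j < q")
    case True
    have "poisson (xmono 0 {j, q}) (Z q) 0 w \<noteq> 0"
      using centralises_pair(2)[OF Z j q(1) True] nz \<gamma> by simp
    then show ?thesis
      using poisson_pair_apply[OF j q(1) True w, of "Z q"] by (auto split: if_splits)
  next
    case False
    then have "q < j"
      using q by simp
    have "poisson (xmono 0 {q, j}) (Z q) 0 w \<noteq> 0"
      using centralises_pair(1)[OF Z q(1) j \<open>q < j\<close>] nz \<gamma> by simp
    then show ?thesis
      using poisson_pair_apply[OF q(1) j \<open>q < j\<close> w, of "Z q"] by (auto split: if_splits)
  qed
  moreover have "w \<subseteq> Y1"
    using w by (simp add: odd_indices_def)
  ultimately show "w = {j} \<or> w = \<omega> - {j}"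
    using j by (cases "j \<in> w") (auto simp: \<omega>_def)
qed

text \<open>The rotation takes \<open>x\<^sub>i\<close> to \<open>x\<^sub>l\<close>.  Thus the linear part of \<open>Z\<close> is a multiple of the Euler field
  of the odd variables, which commutes with all rotations and has to be excluded in another way.\<close>

lemma centralises_linear_coefficient:
  assumes Z: "centralises Z" and il: "i \<in> Y1" "l \<in> Y1" "i < l"
  shows "Z l 0 {l} = Z i 0 {i}"
proof -
  have below: "{k. k = l \<and> k < l} = {}" and "{l} \<in> odd_indices"
    using il by (auto simp: odd_indices_def)
  then show ?thesis
    using poisson_pair_apply[OF il, of "{l}" "Z i"] il by (simp add: centralises_pair[OF Z il] below)
qed

text \<open>The two signs are those of \<open>\<partial>\<^sub>i x\<^sup>\<omega>\<close> and \<open>\<partial>\<^sub>l x\<^sup>\<omega>\<close>, so all components have the same ratio to the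
  derivatives of \<open>x\<^sup>\<omega>\<close>.\<close>

lemma centralises_top_coefficient:
  assumes Z: "centralises Z" and il: "i \<in> Y1" "l \<in> Y1" "i < l"
  shows "Z l 0 (\<omega> - {l}) = (-1) ^ card {k \<in> \<omega>. k < i} * (-1) ^ card {k \<in> \<omega>. k < l} * Z i 0 (\<omega> - {i})"
proof -
  have "{k \<in> \<omega>. k < l} = insert i {k \<in> \<omega> - {l} - {i}. k < l}"
    using il by (auto simp: \<omega>_def)
  then have "card {k \<in> \<omega>. k < l} = Suc (card {k \<in> \<omega> - {l} - {i}. k < l})"
    by (simp add: \<omega>_def)
  moreover have "{k \<in> \<omega> - {l}. k < i} = {k \<in> \<omega>. k < i}" "insert l (\<omega> - {l} - {i}) = \<omega> - {i}"
    "i \<in> \<omega> - {l}" "\<omega> - {l} \<in> odd_indices"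
    using il by (auto simp: \<omega>_def odd_indices_def)
  ultimately show ?thesis
    using poisson_pair_apply[OF il, of "\<omega> - {l}" "Z i"] by (simp add: centralises_pair[OF Z il] del: Diff_iff) simp
qed

text \<open>Commutation with the Hamiltonian field of the cubic \<open>x\<^sub>k x\<^sub>i x\<^sub>l\<close>, where \<open>k\<close> is an even index.
  Its component \<open>k'\<close> is a multiple of \<open>x\<^sub>i x\<^sub>l\<close>, and the component \<open>k'\<close> of \<open>Z\<close> vanishes.\<close>

lemma centralises_act_pair:
  assumes Z: "centralises Z" and il: "i \<in> Y1" "l \<in> Y1" "i < l"
  shows "act Z (xmono 0 {i, l}) = 0"
proof -
  (* any even index would do *)
  define k :: nat where "k = 1"
  have k: "k \<in> Y0" "k \<in> Y" "prime_index k \<in> Y0" "prime_index k \<in> Y" "prime_index (prime_index k) = k"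
    using m_gt by (auto simp: k_def Y0_def Y_def prime_index_def)
  have b: "xmono (unit_index k) {i, l} \<in> (even_O :: 'f superpoly set)"
    using k il unit_multi pair_even_odd by (intro xmono_even_O)
  have "unit_index k - unit_index k = (0 :: nat \<Rightarrow> nat)"
    by (simp add: fun_eq_iff)
  moreover have "unit_index k k \<noteq> 0"
    by (simp add: unit_index_def)
  ultimately have pd: "pd k (xmono (unit_index k) {i, l}) = (xmono 0 {i, l} :: 'f superpoly)"
    using k il empty_odd unit_multi by (simp add: pd_xmono mono_deriv_def)
  have "unit_index k \<noteq> top_index"
    by (rule neq_top[of k]) (simp add: unit_index_def)
  then have "poisson (xmono (unit_index k) {i, l}) (Z (prime_index k))
      = act Z (DH (xmono (unit_index k) {i, l}) (prime_index k))"
    using Z k il unit_multi pair_even_odd by (intro centralises_eq)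
  then have "pscale (\<tau> k) (act Z (xmono 0 {i, l})) = 0"
    using k centralises_even_component[OF Z k(3)]
    by (simp add: DH_even_apply[OF b] pd act_linear poisson_def)
  then show ?thesis
    by (simp add: \<tau>_simps)
qed

text \<open>The derivation \<open>Z\<close> multiplies \<open>x\<^sub>i x\<^sub>l\<close> by twice the common linear coefficient of its odd
  components, and two is invertible.\<close>

lemma centralises_linear_coefficient_zero:
  assumes Z: "centralises Z" and il: "i \<in> Y1" "l \<in> Y1" "i < l"
  shows "Z i 0 {i} = 0"
proof -
  have ZW: "Z \<in> even_W" and Y: "i \<in> Y" "l \<in> Y"
    using Z il by (auto simp: centralises_def Y_def)
  have swap: "pmult (Z q) (xmono 0 {r}) = - pmult (xmono 0 {r}) (Z q)"
    if "q \<in> Y1" "r \<in> Y1" for q r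
    using that pmult_supercommute[of "Z q" 1 "xmono 0 {r}" 1] even_WD[OF ZW, of q] zero_multi empty_odd
    by (simp add: has_parity_xmono)
  have "act Z (xmono 0 {i, l}) = (\<Sum>q\<in>{i, l}. pmult (Z q) (pd q (xmono 0 {i, l})))"
    unfolding act_def using Y il
    by (intro sum.mono_neutral_right) (auto simp: Y_def pd_pair pd_pair_even zero_multi pmult_linear_right)
  also have "\<dots> = pmult (xmono 0 {i}) (Z l) - pmult (xmono 0 {l}) (Z i)"
    using il by (simp add: pd_pair zero_multi pmult_linear_right swap)
  finally have "(pmult (xmono 0 {i}) (Z l) - pmult (xmono 0 {l}) (Z i)) 0 {i, l} = 0"
    using centralises_act_pair[OF Z il] by simp
  moreover have below: "{k. (k = i \<or> k = l) \<and> k < i} = {}" "{k. (k = i \<or> k = l) \<and> k < l} = {i}"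
    and remove: "{i, l} - {i} = {l}" "{i, l} - {l} = {i}"
    using il by auto
  ultimately have "Z l 0 {l} + Z i 0 {i} = 0"
    using il even_WD[OF ZW] by (simp add: pmult_odd_variable_apply below remove)
  then have "2 * Z i 0 {i} = 0"
    by (simp add: centralises_linear_coefficient[OF Z il])
  then show ?thesis
    using two_neq_zero by simp
qed

text \<open>What remains of \<open>Z\<close> are the coefficients of the derivatives of \<open>x\<^sup>\<omega>\<close>.  These have parity
  \<open>n - 1\<close>, while the odd components of an even vector field are odd.\<close>

lemma centralises_imp_multiple:
  assumes Z: "centralises Z"
  shows "even n \<Longrightarrow> \<exists>c. Z = vscale c (DH (xmono 0 \<omega>))" and "odd n \<Longrightarrow> Z = 0"
proof -
  (* the least odd index, so that the relations between coefficients apply to i and any other j *)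
  define i where "i = 2 * m + 1"
  have i: "i \<in> Y1" "i + 1 \<in> Y1" and i_less: "j \<in> Y1 \<Longrightarrow> j \<noteq> i \<Longrightarrow> i < j" for j
    using n_gt by (auto simp: i_def Y1_def)
  have ZW: "Z \<in> even_W"
    using Z by (simp add: centralises_def)
  have linear: "Z j 0 {j} = 0" if "j \<in> Y1" for j
    using that i_less[of j] centralises_linear_coefficient_zero[OF Z i] i
      centralises_linear_coefficient[OF Z i(1) that] by (cases "j = i") auto
  have support: "j \<in> Y1 \<and> \<gamma> = 0 \<and> w = \<omega> - {j}" if "Z j \<gamma> w \<noteq> 0" for j \<gamma> w
  proof -
    have "Z j \<noteq> 0"
      using that by auto
    then have j: "j \<in> Y1"
      using centralises_even_component[OF Z, of j] even_WD(3)[OF ZW, of j] by (auto simp: Y_def)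
    have "\<gamma> = 0" "w = {j} \<or> w = \<omega> - {j}"
      using centralises_support[OF Z j, of \<gamma> w] that by simp_all
    moreover have "w \<noteq> {j}"
      using that linear[OF j] \<open>\<gamma> = 0\<close> by blast
    ultimately show ?thesis
      using j by blast
  qed
  have card: "card (\<omega> - {j}) = n - 1" if "j \<in> Y1" for j
    using that by (simp add: \<omega>_def) (simp add: Y1_def)
  show "Z = 0" if "odd n"
  proof (rule ccontr)
    assume "Z \<noteq> 0"
    then obtain j \<gamma> w where nz: "Z j \<gamma> w \<noteq> 0"
      by (auto simp: fun_eq_iff)
    then have "card w mod 2 = 1"
      using even_WD(2)[OF ZW, of j] support[OF nz] by (auto simp: has_parity_def)
    then show False
      using support[OF nz] card that n_gt by auto
  qed
  show "\<exists>c. Z = vscale c (DH (xmono 0 \<omega>))" if "even n"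
  proof -
    define c where "c = (-1) ^ card {k \<in> \<omega>. k < i} * Z i 0 (\<omega> - {i})"
    have c: "Z j 0 (\<omega> - {j}) = c * (-1) ^ card {k \<in> \<omega>. k < j}" if "j \<in> Y1" for j
    proof (cases "j = i")
      case True
      then show ?thesis
        by (simp add: c_def power_mult_distrib[symmetric] mult_ac flip: mult.assoc)
    next
      case False
      then show ?thesis
        using centralises_top_coefficient[OF Z i(1) that i_less[OF that]] by (simp add: c_def mult_ac)
    qed
    have omega: "\<omega> \<in> odd_indices" "\<omega> \<in> even_odd_indices"
      using that by (simp_all add: \<omega>_def odd_indices_def even_odd_indices_def Y1_def)
    have DH: "DH (xmono 0 \<omega>) j \<gamma> w = (if j \<in> Y1 \<and> \<gamma> = 0 \<and> w = \<omega> - {j}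
        then (-1) ^ card {k \<in> \<omega>. k < j} else (0 :: 'f))" for j \<gamma> w
    proof (cases "j \<in> Y1")
      case True
      then have "pd j (xmono 0 \<omega> :: 'f superpoly)
          = pscale ((-1) ^ card {k \<in> \<omega>. k < j}) (xmono 0 (\<omega> - {j}))"
        using omega(1) zero_multi Y1_not_Y0 by (simp add: pd_xmono mono_deriv_def \<omega>_def)
      then show ?thesis
        using True omega(2) zero_multi
        by (simp add: DH_even_apply xmono_even_O Y_def prime_index_in \<tau>_simps xmono_apply)
    next
      case False
      then show ?thesis
        using omega zero_multi
        by (auto simp: DH_even_apply xmono_even_O Y_def prime_index_in pd_xmono mono_deriv_def)
    qed
    have "Z = vscale c (DH (xmono 0 \<omega>))"
    proof (intro ext)
      fix j \<gamma> w
      show "Z j \<gamma> w = vscale c (DH (xmono 0 \<omega>)) j \<gamma> w"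
        using support[of j \<gamma> w] c[of j] by (cases "j \<in> Y1 \<and> \<gamma> = 0 \<and> w = \<omega> - {j}") (auto simp: DH)
    qed
    then show ?thesis ..
  qed
qed

section \<open>Derivations that vanish on the ideal\<close>

text \<open>For \<open>y\<close> in \<open>\<NN>\<close> both \<open>\<phi> y\<close> and \<open>\<phi> [x, y]\<close> vanish, so the derivation rule reduces to
  \<open>[y, \<phi> x] = 0\<close>.\<close>

lemma Der_value_centralises:
  assumes \<phi>: "\<phi> \<in> Der" "\<forall>x\<in>\<NN>. \<phi> x = 0" and x: "x \<in> even_H"
  shows "centralises (\<phi> x)"
  unfolding centralises_def
proof (intro conjI ballI)
  show "\<phi> x \<in> even_W"
    using \<phi>(1) x by (auto simp: Der_def)
  fix y :: "'f vfield"
  assume y: "y \<in> \<NN>"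
  then have yH: "y \<in> even_H"
    using NN_subset_even_H by blast
  have "\<phi> (bracket x y) = bracket x (\<phi> y) - bracket y (\<phi> x)"
    using \<phi>(1) x yH by (auto simp: Der_def)
  moreover have "bracket x y \<in> \<NN>"
    using x yH by (rule bracket_even_H)
  moreover have "x \<in> even_W"
    using even_H_DH[OF x] DH_even_W by blast
  then have "bracket x 0 = 0"
    by (simp add: fun_eq_iff[of "bracket x 0"] bracket_even zero_even_W act_linear)
      (simp add: act_def pmult_linear_left)
  ultimately show "bracket y (\<phi> x) = 0"
    using \<phi>(2) y by simp
qed

lemma value_determined:
  assumes lin: "linear_map_on even_H \<phi>" and zero: "\<forall>x\<in>\<NN>. \<phi> x = 0" and x: "x \<in> even_H"
  obtains k where "\<phi> x = vscale k (\<phi> (DH (xmono top_index {})) :: 'f vfield)"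
proof -
  obtain y k where y: "y \<in> \<NN>" "x = y + vscale k (DH (xmono top_index {}))"
    using x by (rule even_H_decompose)
  have yH: "y \<in> even_H"
    using y(1) NN_subset_even_H by blast
  have "vscale k (DH (xmono top_index {}) :: 'f vfield) \<in> even_H"
    using DH_top_even_H unfolding even_H_def by (rule vfield.span_scale)
  then have "\<phi> (y + vscale k (DH (xmono top_index {}))) = \<phi> y + \<phi> (vscale k (DH (xmono top_index {})))"
    using lin yH unfolding linear_map_on_def by blast
  moreover have "\<phi> (vscale k (DH (xmono top_index {}))) = vscale k (\<phi> (DH (xmono top_index {})))"
    using lin DH_top_even_H unfolding linear_map_on_def by blast
  ultimately have "\<phi> x = \<phi> y + vscale k (\<phi> (DH (xmono top_index {})))"
    by (simp only: y(2))
  then show ?thesis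
    using zero y(1) by (intro that[of k]) simp
qed

text \<open>All brackets lie in \<open>\<NN>\<close>, where \<open>\<phi>\<close> vanishes, and all values of \<open>\<phi>\<close> are multiples of the
  Hamiltonian field of \<open>x\<^sup>\<omega>\<close>, which commutes with the whole of \<open>even_H\<close>.  So both sides of the
  derivation rule are zero.\<close>

lemma DerI_vanishing:
  assumes "even n" and lin: "linear_map_on even_H \<phi>" and img: "\<phi> ` even_H \<subseteq> even_W"
    and zero: "\<forall>x\<in>\<NN>. \<phi> x = 0"
    and top: "\<phi> (DH (xmono top_index {})) = (vscale c (DH (xmono 0 \<omega>)) :: 'f vfield)"
  shows "\<phi> \<in> Der"
proof -
  have omega: "xmono 0 \<omega> \<in> (even_O :: 'f superpoly set)"
    using assms(1) by (intro xmono_even_O zero_multi)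
      (simp add: \<omega>_def odd_indices_def even_odd_indices_def Y1_def)
  have "bracket x (\<phi> y) = 0" if x: "x \<in> even_H" and y: "y \<in> even_H" for x y
  proof -
    obtain k where "\<phi> y = vscale k (\<phi> (DH (xmono top_index {})))"
      using lin zero y by (rule value_determined)
    then have "\<phi> y = DH (pscale (k * c) (xmono 0 \<omega>))"
      by (simp add: top DH_linear omega)
    moreover obtain a where "a \<in> even_O" "x = DH a"
      using x by (rule even_H_DH)
    moreover have "poisson a (pscale (k * c) (xmono 0 \<omega>)) = (0 :: 'f superpoly)" if "a \<in> even_O" for a
      using poisson_xmono_omega[OF that] by (simp add: poisson_def act_linear)
    ultimately show ?thesis
      using omega by (simp add: DH_bracket DH_zero)
  qed
  then show ?thesis
    using lin img zero bracket_even_H by (auto simp: Der_def)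
qed

end

theorem theorem2p4:
  fixes m n p :: nat and t :: "nat \<Rightarrow> nat"
  assumes "CHAR('f::field) = p" and "p > 3" and "m > 1" and "n > 3"
    and "\<forall>i\<in>{1..2 * m}. t i > 0"
  shows
    "(\<forall>\<phi> \<in> hamiltonian.Der m n p t :: ('f vfield \<Rightarrow> 'f vfield) set.
        (\<forall>x \<in> hamiltonian.\<NN> m n p t. \<phi> x = 0) \<longrightarrow>
          (odd n \<longrightarrow> (\<forall>x \<in> hamiltonian.even_H m n p t. \<phi> x = 0)) \<and>
          (even n \<longrightarrow>
            (\<exists>c. \<phi> (hamiltonian.DH m n p t (xmono (hamiltonian.top_index m p t) {}))
               = vscale c (hamiltonian.DH m n p t (xmono 0 (hamiltonian.\<omega> m n)))))) \<and>
     (even n \<longrightarrow>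
        (\<forall>(\<phi> :: 'f vfield \<Rightarrow> 'f vfield) c.
           linear_map_on (hamiltonian.even_H m n p t) \<phi> \<and>
           \<phi> ` hamiltonian.even_H m n p t \<subseteq> hamiltonian.even_W m n p t \<and>
           (\<forall>x \<in> hamiltonian.\<NN> m n p t. \<phi> x = 0) \<and>
           \<phi> (hamiltonian.DH m n p t (xmono (hamiltonian.top_index m p t) {}))
             = vscale c (hamiltonian.DH m n p t (xmono 0 (hamiltonian.\<omega> m n)))
           \<longrightarrow> \<phi> \<in> hamiltonian.Der m n p t))"
proof -
  interpret hamiltonian_field m n p t "TYPE('f)"
    using assms by unfold_locales auto
  show ?thesis
  proof (intro conjI ballI impI allI)
    fix \<phi> :: "'f vfield \<Rightarrow> 'f vfield" and x :: "'f vfield"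
    assume "\<phi> \<in> Der" "\<forall>x\<in>\<NN>. \<phi> x = 0" "odd n" "x \<in> even_H"
    then show "\<phi> x = 0"
      using Der_value_centralises[of \<phi> x] centralises_imp_multiple(2)[of "\<phi> x"] by simp
  next
    fix \<phi> :: "'f vfield \<Rightarrow> 'f vfield"
    assume "\<phi> \<in> Der" "\<forall>x\<in>\<NN>. \<phi> x = 0" "even n"
    then show "\<exists>c. \<phi> (DH (xmono top_index {})) = vscale c (DH (xmono 0 \<omega>))"
      using centralises_imp_multiple(1)[OF Der_value_centralises] DH_top_even_H by simp
  next
    fix \<phi> :: "'f vfield \<Rightarrow> 'f vfield" and c
    assume "even n" and "linear_map_on even_H \<phi> \<and> \<phi> ` even_H \<subseteq> even_W \<and> (\<forall>x\<in>\<NN>. \<phi> x = 0) \<and>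
      \<phi> (DH (xmono top_index {})) = vscale c (DH (xmono 0 \<omega>))"
    then show "\<phi> \<in> Der"
      using DerI_vanishing by blast
  qed
qed

end
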